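(* Let $(V,E)$ be a non-commutative probability space over $\mathbb{K}$, regarded as a $\mathbb{K}$-valued homotopy $\mathcal{N}$-probability space for the non-crossing word cooperad $\mathcal{N}=(\mathsf{N},\epsilon,\Delta)$, and let $K:\mathsf{N}\circ V\to\mathbb{K}$ be its cumulant morphism. Then $K$ recovers the free cumulants $\{\kappa_N\}_{N\geq 1}$ of $(V,E)$: for each $N\ge 1$, with $w_N$ denoting the word $1,2,\ldots,N$ in the alphabet $[N]=\{1,\ldots,N\}$, $$K\big(w_N\otimes(v_1\otimes\cdots\otimes v_N)\big)=\kappa_N(v_1\otimes\cdots\otimes v_N)\qquad\text{for all }v_1,\ldots,v_N\in V.$$
   Context: $\mathbb{K}$ is a field of characteristic zero. **Non-commutative probability spaces and free cumulants.** A non-commutative probability space $(V,E)$ is a unital associative $\mathbb{K}$-algebra $V$ with a unit-preserving linear map $E:V\to\mathbb{K}$ (no further compatibility is assumed). A non-crossing partition of $N$ of size $k$ is a surjection $f:[N]\to[k]$ such that $i<j$ implies $\min f^{-1}(i)<\min f^{-1}(j)$, and the word $f(1),f(2),\ldots,f(N)$ on $[k]$ is non-crossing (defined below). Given functionals $\rho_n:V^{\otimes n}\to\mathbb{K}$ ($n\ge1$), the multiplicative extension is $\rho_f(a_1\otimes\cdots\otimes a_N)=\prod_{i=1}^k\rho_{|f^{-1}(i)|}(a_{j_1}\otimes\cdots\otimes a_{j_m})$, where $j_1<\cdots<j_m$ are the elements of $f^{-1}(i)$. The free cumulants of $(V,E)$ are the unique functionals $\kappa_N:V^{\otimes N}\to\mathbb{K}$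 such that $E(a_1\cdots a_N)=\sum_f\kappa_f(a_1\otimes\cdots\otimes a_N)$ for all $N$ and all $a_i\in V$, the sum being over all non-crossing partitions $f$ of $N$. **Words.** A word is a nonempty finite sequence of letters from an alphabet $S$. It is pangrammatic if it contains every letter of $S$; reduced if it has no subword (of consecutive letters) $aa$ and either has length one or has different first and last letters; non-crossing if it never contains a pattern $\ldots a\ldots b\ldots a\ldots b\ldots$ for distinct letters $a,b$, and crossing otherwise. The reduction $\overline{w}$ is the unique minimal length word obtained from $w$ by repeatedly applying $\ldots aa\ldots\mapsto\ldots a\ldots$ and $a\ldots a\mapsto a\ldots$ (in the latter, $a$ is both first and last letter of the entire word, of length at least two, and the last letter is deleted). A map of sets $f:S\to T$ acts on words letter by letter; $w|S'$ is $w$ with all letters not in $S'$ deleted. **The non-crossing word cooperad.** A species is a functor from finite sets and bijections to vector spaces. $\mathsf{N}(S)$ is the $\mathbb{K}$-span of the pangrammatic reduced non-crossing words on $S$ (bijections act by relabeling). A cooperad is a comonoid in the monoidal category of species vanishing on $\emptyset$, with product the invariant plethysm $(\mathsf{F}\,\bar{\circ}\,\mathsf{G})(S)=\lim_{f:S\to T}\mathsf{F}(T)\otimes\bigotimes_{t\in T}\mathsf{G}(f^{-1}(t))$ (limit over maps out of $S$ and isomorphisms under $S$) and unit the species $\mathsf{I}$ with value $\mathbb{K}$ on singletons and $0$ otherwise. $\mathcal{N}=(\mathsf{N},\epsilon,\Delta)$ is the cooperad whose counit sends the unique word on a singleton to $1$ and whose decomposition map has, at a surjection $f:S\twoheadrightarrow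 T$, the component $\Delta_f(w)=\overline{f(w)}\otimes\bigotimes_{t\in T}\overline{w|f^{-1}(t)}$ if $f(w)$ is non-crossing, and $0$ if $f(w)$ is crossing. **Schur functor and cofree coalgebras.** For a vector space $V$, $\mathsf{N}\circ V=\operatorname{colim}_S\mathsf{N}(S)\otimes V^{\otimes S}$, the colimit being over finite sets $S$ and bijections; the class of $w\otimes z$ is again denoted $w\otimes z$. The cooperad structure makes $\mathsf{N}\circ$ a comonad, with comultiplication $\delta_V:\mathsf{N}\circ V\to\mathsf{N}\circ(\mathsf{N}\circ V)$ given, for $w\in\mathsf{N}(S)$ and $z=\bigotimes_{s\in S}v_s$, by $$\delta_V(w\otimes z)=\sum_f\overline{f(w)}\otimes\bigotimes_{t\in T}\Big(\overline{w|f^{-1}(t)}\otimes\bigotimes_{s\in f^{-1}(t)}v_s\Big),$$ summed over representatives $f:S\twoheadrightarrow T$ of the isomorphism classes (under $S$) of surjections out of $S$ for which $f(w)$ is non-crossing. Write $\mathcal{N}\circ V$ for $\mathsf{N}\circ V$ with the resulting cofree conilpotent $\mathcal{N}$-coalgebra structure. A linear map $g:\mathsf{N}\circ V\to V'$ corresponds by adjunction to the coalgebra map $\tilde g=(\mathsf{N}\circ g)\,\delta_V:\mathcal{N}\circ V\to\mathcal{N}\circ V'$; $g$ is recovered by composing $\tilde g$ with the counit $\mathsf{N}\circ V'\to\mathsf{I}\circ V'\cong V'$. **$\mathcal{N}$-probability spaces and cumulant morphism.** An $\mathcal{N}$-correlation algebra is here a vector space $V$ with a linear map $\varphi_V:\mathsf{N}\circ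 V\to V$ restricting to the identity on $V\cong\mathsf{N}(S)\otimes V$ for $|S|=1$. A $\mathbb{K}$-valued homotopy $\mathcal{N}$-probability space is an $\mathcal{N}$-correlation algebra $(V,\varphi_V)$ with linear maps $\eta:\mathbb{K}\to V$ and $E:V\to\mathbb{K}$ such that $\varphi_V\circ(\mathsf{N}\circ\eta)=\eta\circ\varphi_{\mathbb{K}}$ and $E\circ\eta=\mathrm{id}_{\mathbb{K}}$, where $\mathbb{K}$ has a fixed $\mathcal{N}$-correlation algebra structure $\varphi_{\mathbb{K}}$. A non-commutative probability space $(V,E)$ is viewed as such by taking $\eta$ to be the unit of the algebra and, for $A=V$ and for $A=\mathbb{K}$, $$\varphi_A\Big(w\otimes\bigotimes_{s\in S}a_s\Big)=a_{s_1}a_{s_2}\cdots a_{s_n},$$ where $s_1,\ldots,s_n$ are the letters of $S$ listed in the order of their first occurrence in the word $w$. The map $\tilde\varphi_{\mathbb{K}}$ is an automorphism of the coalgebra $\mathcal{N}\circ\mathbb{K}$, and the cumulant morphism is the unique coalgebra map $\tilde K:\mathcal{N}\circ V\to\mathcal{N}\circ\mathbb{K}$ with $$\tilde\varphi_{\mathbb{K}}\circ\tilde K=(\mathcal{N}\circ E)\circ\tilde\varphi_V,$$ or equivalently its adjoint linear map $K:\mathsf{N}\circ V\to\mathbb{K}$. *)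

theory Defs
  imports "HOL-Algebra.Module" "HOL-Algebra.AbelCoset" "HOL-Library.Sublist"
begin

section \<open>Words\<close>

definition crossing :: "'a list \<Rightarrow> bool" where
  "crossing w \<longleftrightarrow> (\<exists>a b. a \<noteq> b \<and> subseq [a, b, a, b] w)"

definition reduced :: "'a list \<Rightarrow> bool" where
  "reduced w \<longleftrightarrow> distinct_adj w \<and> (length w = 1 \<or> hd w \<noteq> last w)"

inductive reduce_step :: "'a list \<Rightarrow> 'a list \<Rightarrow> bool" where
  adjacent: "reduce_step (u @ [a, a] @ v) (u @ [a] @ v)"
| ends: "reduce_step (a # u @ [a]) (a # u)"

definition reduction :: "'a list \<Rightarrow> 'a list" where
  "reduction w = (THE u. reduce_step\<^sup>*\<^sup>* w u \<and>
     (\<forall>u'. reduce_step\<^sup>*\<^sup>* w u' \<longrightarrow> length u \<le> length u'))"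

text \<open>The basis of \<open>N(S)\<close>: pangrammatic reduced non-crossing words on \<open>S\<close>.\<close>

definition nc_words :: "'a set \<Rightarrow> 'a list set" where
  "nc_words S = {w. w \<noteq> [] \<and> set w = S \<and> reduced w \<and> \<not> crossing w}"

text \<open>Library \<^const>\<open>remdups\<close> keeps the last occurrence of each letter; here the
  letters are listed in the order of their first occurrence.\<close>

definition first_occurrences :: "'a list \<Rightarrow> 'a list" where
  "first_occurrences w = rev (remdups (rev w))"

text \<open>Every isomorphism class, under a finite set \<open>S\<close> of natural numbers, of surjections
  out of \<open>S\<close> contains exactly one surjection onto some \<open>{1..k}\<close> whose fibres are
  numbered in the order of their least elements.\<close>

definition surj_reps :: "nat set \<Rightarrow> (nat \<Rightarrow> nat) set" where
  "surj_reps S = {f \<in> extensional S. \<exists>k. f ` S = {1..k} \<and>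
     (\<forall>i\<in>{1..k}. \<forall>j\<in>{1..k}. i < j \<longrightarrow> Min {s \<in> S. f s = i} < Min {s \<in> S. f s = j})}"

definition nc_partitions :: "nat \<Rightarrow> (nat \<Rightarrow> nat) set" where
  "nc_partitions N = {f \<in> surj_reps {1..N}. \<not> crossing (map f [1..<Suc N])}"


section \<open>Linear algebra over a field\<close>

text \<open>A vector space over \<open>K\<close> is a record \<open>M\<close> with \<^term>\<open>module K M\<close>.  The
  multiplicative fields of the record play no role for vector spaces and are left
  undefined in free modules and quotients.\<close>

definition linear_maps ::
    "('k, 'm) ring_scheme \<Rightarrow> ('k, 'a, 'x) module_scheme \<Rightarrow> ('k, 'b, 'y) module_scheme \<Rightarrow> ('a \<Rightarrow> 'b) set" where
  "linear_maps K M M' = {h \<in> carrier M \<rightarrow> carrier M'.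
     (\<forall>x\<in>carrier M. \<forall>y\<in>carrier M. h (x \<oplus>\<^bsub>M\<^esub> y) = h x \<oplus>\<^bsub>M'\<^esub> h y) \<and>
     (\<forall>c\<in>carrier K. \<forall>x\<in>carrier M. h (c \<odot>\<^bsub>M\<^esub> x) = c \<odot>\<^bsub>M'\<^esub> h x)}"

text \<open>\<open>K\<close> as an algebra over itself.\<close>

definition scalars :: "('k, 'm) ring_scheme \<Rightarrow> ('k, 'k) module" where
  "scalars K = \<lparr>carrier = carrier K, mult = mult K, one = one K, zero = zero K, add = add K,
     smult = mult K\<rparr>"

definition submodule_generated ::
    "('k, 'm) ring_scheme \<Rightarrow> ('k, 'a, 'x) module_scheme \<Rightarrow> 'a set \<Rightarrow> 'a set" where
  "submodule_generated K M X = \<Inter>{H. submodule H K M \<and> X \<subseteq> H}"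

definition quotient_module :: "('k, 'a, 'x) module_scheme \<Rightarrow> 'a set \<Rightarrow> ('k, 'a set) module" where
  "quotient_module M H = \<lparr>carrier = a_rcosets\<^bsub>M\<^esub> H, mult = undefined, one = undefined,
     zero = H, add = set_add M, smult = (\<lambda>c X. \<Union>x\<in>X. H +>\<^bsub>M\<^esub> (c \<odot>\<^bsub>M\<^esub> x))\<rparr>"

definition free_module :: "('k, 'm) ring_scheme \<Rightarrow> 'g set \<Rightarrow> ('k, 'g \<Rightarrow> 'k) module" where
  "free_module K G = \<lparr>carrier = {x. range x \<subseteq> carrier K \<and> finite {g. x g \<noteq> \<zero>\<^bsub>K\<^esub>} \<and> {g. x g \<noteq> \<zero>\<^bsub>K\<^esub>} \<subseteq> G},
     mult = undefined, one = undefined, zero = (\<lambda>_. \<zero>\<^bsub>K\<^esub>),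
     add = (\<lambda>x y g. x g \<oplus>\<^bsub>K\<^esub> y g), smult = (\<lambda>c x g. c \<otimes>\<^bsub>K\<^esub> x g)\<rparr>"

definition free_gen :: "('k, 'm) ring_scheme \<Rightarrow> 'g \<Rightarrow> 'g \<Rightarrow> 'k" where
  "free_gen K g = (\<lambda>g'. if g' = g then \<one>\<^bsub>K\<^esub> else \<zero>\<^bsub>K\<^esub>)"


section \<open>The Schur functor of the species of non-crossing words\<close>

text \<open>\<open>N \<circ> V\<close> is the colimit of \<open>N(S) \<otimes> V\<^sup>\<otimes>\<^sup>S\<close> over finite sets \<open>S\<close> and bijections; up to
  equivalence of categories, \<open>S\<close> ranges over the finite sets of natural numbers.  Since \<open>N(S)\<close>
  has the basis \<^term>\<open>nc_words S\<close>, the colimit is generated by the symbols \<open>w \<otimes> z\<close>,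
  for \<open>w \<in> nc_words S\<close> and a family \<open>z\<close> of vectors indexed by \<open>S = set w\<close>, subject to
  multilinearity in \<open>z\<close> and to invariance under relabelling.\<close>

type_synonym 'v decorated = "nat list \<times> (nat \<Rightarrow> 'v)"

definition decorated_words :: "('k, 'v, 'x) module_scheme \<Rightarrow> 'v decorated set" where
  "decorated_words V = {(w, z). w \<in> nc_words (set w) \<and> z \<in> set w \<rightarrow>\<^sub>E carrier V}"

abbreviation free_decorated ::
    "('k, 'm) ring_scheme \<Rightarrow> ('k, 'v, 'x) module_scheme \<Rightarrow> ('k, 'v decorated \<Rightarrow> 'k) module" where
  "free_decorated K V \<equiv> free_module K (decorated_words V)"

inductive_set schur_relations ::
    "('k, 'm) ring_scheme \<Rightarrow> ('k, 'v, 'x) module_scheme \<Rightarrow> ('v decorated \<Rightarrow> 'k) set"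
  for K :: "('k, 'm) ring_scheme" and V :: "('k, 'v, 'x) module_scheme" where
  additive: "\<lbrakk>(w, z) \<in> decorated_words V; s \<in> set w; a \<in> carrier V; b \<in> carrier V\<rbrakk> \<Longrightarrow>
    free_gen K (w, z(s := a \<oplus>\<^bsub>V\<^esub> b))
      \<ominus>\<^bsub>free_decorated K V\<^esub> (free_gen K (w, z(s := a)) \<oplus>\<^bsub>free_decorated K V\<^esub> free_gen K (w, z(s := b)))
      \<in> schur_relations K V"
| homogeneous: "\<lbrakk>(w, z) \<in> decorated_words V; s \<in> set w; c \<in> carrier K; a \<in> carrier V\<rbrakk> \<Longrightarrow>
    free_gen K (w, z(s := c \<odot>\<^bsub>V\<^esub> a))
      \<ominus>\<^bsub>free_decorated K V\<^esub> (c \<odot>\<^bsub>free_decorated K V\<^esub> free_gen K (w, z(s := a)))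
      \<in> schur_relations K V"
| relabel: "\<lbrakk>inj_on \<sigma> (set w); (map \<sigma> w, z) \<in> decorated_words V\<rbrakk> \<Longrightarrow>
    free_gen K (map \<sigma> w, z) \<ominus>\<^bsub>free_decorated K V\<^esub> free_gen K (w, restrict (z \<circ> \<sigma>) (set w))
      \<in> schur_relations K V"

abbreviation schur_null ::
    "('k, 'm) ring_scheme \<Rightarrow> ('k, 'v, 'x) module_scheme \<Rightarrow> ('v decorated \<Rightarrow> 'k) set" where
  "schur_null K V \<equiv> submodule_generated K (free_decorated K V) (schur_relations K V)"

definition schur ::
    "('k, 'm) ring_scheme \<Rightarrow> ('k, 'v, 'x) module_scheme \<Rightarrow> ('k, ('v decorated \<Rightarrow> 'k) set) module" where
  "schur K V = quotient_module (free_decorated K V) (schur_null K V)"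

text \<open>The class of \<open>w \<otimes> z\<close>; only the values of \<open>z\<close> on the letters of \<open>w\<close> matter.\<close>

definition schur_class ::
    "('k, 'm) ring_scheme \<Rightarrow> ('k, 'v, 'x) module_scheme \<Rightarrow> nat list \<Rightarrow> (nat \<Rightarrow> 'v)
      \<Rightarrow> ('v decorated \<Rightarrow> 'k) set" where
  "schur_class K V w z = schur_null K V +>\<^bsub>free_decorated K V\<^esub> free_gen K (w, restrict z (set w))"

text \<open>The linear map \<open>N \<circ> V \<rightarrow> W\<close> given on generators by \<open>w \<otimes> z \<mapsto> F w z\<close>, where \<open>F w z\<close> is
  multilinear in \<open>z\<close> and invariant under relabelling.\<close>

definition schur_lift ::
    "('k, 'm) ring_scheme \<Rightarrow> ('k, 'v, 'x) module_scheme \<Rightarrow> ('k, 'w, 'y) module_scheme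
      \<Rightarrow> (nat list \<Rightarrow> (nat \<Rightarrow> 'v) \<Rightarrow> 'w) \<Rightarrow> ('v decorated \<Rightarrow> 'k) set \<Rightarrow> 'w" where
  "schur_lift K V W F = (THE h.
     h \<in> linear_maps K (schur K V) W \<and> h \<in> extensional (carrier (schur K V)) \<and>
     (\<forall>(w, z) \<in> decorated_words V. h (schur_class K V w z) = F w z))"

text \<open>The action \<open>N \<circ> g\<close> on a linear map \<open>g\<close> from \<open>V\<close> to \<open>W\<close>.\<close>

definition schur_map ::
    "('k, 'm) ring_scheme \<Rightarrow> ('k, 'v, 'x) module_scheme \<Rightarrow> ('k, 'w, 'y) module_scheme
      \<Rightarrow> ('v \<Rightarrow> 'w) \<Rightarrow> ('v decorated \<Rightarrow> 'k) set \<Rightarrow> ('w decorated \<Rightarrow> 'k) set" where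
  "schur_map K V W g = schur_lift K V (schur K W) (\<lambda>w z. schur_class K W w (g \<circ> z))"


section \<open>The comonad of the non-crossing word cooperad and its cofree coalgebras\<close>

definition schur_counit ::
    "('k, 'm) ring_scheme \<Rightarrow> ('k, 'v, 'x) module_scheme \<Rightarrow> ('v decorated \<Rightarrow> 'k) set \<Rightarrow> 'v" where
  "schur_counit K V = schur_lift K V V (\<lambda>w z. if card (set w) = 1 then z (hd w) else \<zero>\<^bsub>V\<^esub>)"

definition schur_comult ::
    "('k, 'm) ring_scheme \<Rightarrow> ('k, 'v, 'x) module_scheme \<Rightarrow> ('v decorated \<Rightarrow> 'k) set
      \<Rightarrow> (('v decorated \<Rightarrow> 'k) set decorated \<Rightarrow> 'k) set" where
  "schur_comult K V = schur_lift K V (schur K (schur K V)) (\<lambda>w z.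
     \<Oplus>\<^bsub>schur K (schur K V)\<^esub> f \<in> {f \<in> surj_reps (set w). \<not> crossing (map f w)}.
       schur_class K (schur K V) (reduction (map f w))
         (\<lambda>t. schur_class K V (reduction (filter (\<lambda>s. f s = t) w)) z))"

text \<open>The coalgebra map \<open>\<N> \<circ> V \<rightarrow> \<N> \<circ> W\<close> adjoint to a linear map \<open>g\<close> from \<open>N \<circ> V\<close> to \<open>W\<close>.\<close>

definition cofree_lift ::
    "('k, 'm) ring_scheme \<Rightarrow> ('k, 'v, 'x) module_scheme \<Rightarrow> ('k, 'w, 'y) module_scheme
      \<Rightarrow> (('v decorated \<Rightarrow> 'k) set \<Rightarrow> 'w) \<Rightarrow> ('v decorated \<Rightarrow> 'k) set \<Rightarrow> ('w decorated \<Rightarrow> 'k) set" where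
  "cofree_lift K V W g = schur_map K (schur K V) W g \<circ> schur_comult K V"

definition coalgebra_map ::
    "('k, 'm) ring_scheme \<Rightarrow> ('k, 'v, 'x) module_scheme \<Rightarrow> ('k, 'w, 'y) module_scheme
      \<Rightarrow> (('v decorated \<Rightarrow> 'k) set \<Rightarrow> ('w decorated \<Rightarrow> 'k) set) \<Rightarrow> bool" where
  "coalgebra_map K V W F \<longleftrightarrow> F \<in> linear_maps K (schur K V) (schur K W) \<and>
     (\<forall>x\<in>carrier (schur K V).
        schur_comult K W (F x) = schur_map K (schur K V) (schur K W) F (schur_comult K V x))"


section \<open>Non-commutative probability spaces\<close>

definition nc_probability_space ::
    "('k, 'm) ring_scheme \<Rightarrow> ('k, 'v, 'x) module_scheme \<Rightarrow> ('v \<Rightarrow> 'k) \<Rightarrow> bool" where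
  "nc_probability_space K V E \<longleftrightarrow>
     ring V \<and> module K V \<and>
     (\<forall>c\<in>carrier K. \<forall>x\<in>carrier V. \<forall>y\<in>carrier V.
        (c \<odot>\<^bsub>V\<^esub> x) \<otimes>\<^bsub>V\<^esub> y = c \<odot>\<^bsub>V\<^esub> (x \<otimes>\<^bsub>V\<^esub> y) \<and> x \<otimes>\<^bsub>V\<^esub> (c \<odot>\<^bsub>V\<^esub> y) = c \<odot>\<^bsub>V\<^esub> (x \<otimes>\<^bsub>V\<^esub> y)) \<and>
     E \<in> linear_maps K V (scalars K) \<and> E \<one>\<^bsub>V\<^esub> = \<one>\<^bsub>K\<^esub>"

definition list_product :: "('a, 'm) monoid_scheme \<Rightarrow> 'a list \<Rightarrow> 'a" where
  "list_product A as = foldr (mult A) as \<one>\<^bsub>A\<^esub>"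

text \<open>A functional on \<open>V\<^sup>\<otimes>\<^sup>n\<close> is given as a multilinear function of the lists of length \<open>n\<close>.\<close>

definition multilinear_form ::
    "('k, 'm) ring_scheme \<Rightarrow> ('k, 'v, 'x) module_scheme \<Rightarrow> nat \<Rightarrow> ('v list \<Rightarrow> 'k) \<Rightarrow> bool" where
  "multilinear_form K V n \<rho> \<longleftrightarrow>
     (\<forall>as. length as = n \<and> set as \<subseteq> carrier V \<longrightarrow> \<rho> as \<in> carrier K \<and>
       (\<forall>i<n. \<forall>x\<in>carrier V. \<forall>y\<in>carrier V.
          \<rho> (as[i := x \<oplus>\<^bsub>V\<^esub> y]) = \<rho> (as[i := x]) \<oplus>\<^bsub>K\<^esub> \<rho> (as[i := y])) \<and>
       (\<forall>i<n. \<forall>c\<in>carrier K. \<forall>x\<in>carrier V.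
          \<rho> (as[i := c \<odot>\<^bsub>V\<^esub> x]) = c \<otimes>\<^bsub>K\<^esub> \<rho> (as[i := x])))"

definition mult_extension ::
    "('k, 'm) ring_scheme \<Rightarrow> (nat \<Rightarrow> 'v list \<Rightarrow> 'k) \<Rightarrow> nat \<Rightarrow> (nat \<Rightarrow> nat) \<Rightarrow> (nat \<Rightarrow> 'v) \<Rightarrow> 'k" where
  "mult_extension K \<rho> N f a =
     (\<Otimes>\<^bsub>K\<^esub> i \<in> f ` {1..N}. \<rho> (card {j \<in> {1..N}. f j = i}) (map a (filter (\<lambda>j. f j = i) [1..<Suc N])))"

definition free_cumulants ::
    "('k, 'm) ring_scheme \<Rightarrow> ('k, 'v, 'x) module_scheme \<Rightarrow> ('v \<Rightarrow> 'k)
      \<Rightarrow> (nat \<Rightarrow> 'v list \<Rightarrow> 'k) \<Rightarrow> bool" where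
  "free_cumulants K V E \<kappa> \<longleftrightarrow>
     (\<forall>N\<ge>1. multilinear_form K V N (\<kappa> N)) \<and>
     (\<forall>N\<ge>1. \<forall>a \<in> {1..N} \<rightarrow> carrier V.
        E (list_product V (map a [1..<Suc N])) = (\<Oplus>\<^bsub>K\<^esub> f \<in> nc_partitions N. mult_extension K \<kappa> N f a))"


section \<open>The cumulant morphism\<close>

definition algebra_correlation ::
    "('k, 'm) ring_scheme \<Rightarrow> ('k, 'a, 'x) module_scheme \<Rightarrow> ('a decorated \<Rightarrow> 'k) set \<Rightarrow> 'a" where
  "algebra_correlation K A =
     schur_lift K A A (\<lambda>w a. list_product A (map a (first_occurrences w)))"

text \<open>The cumulant morphism of a homotopy probability space with correlation structures
  \<open>\<phi>\<^sub>V\<close> and \<open>\<phi>\<^sub>K\<close> and expectation \<open>E\<close>, as a coalgebra map; the unit of the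
  space does not enter.\<close>

definition cumulant_morphism ::
    "('k, 'm) ring_scheme \<Rightarrow> ('k, 'v, 'x) module_scheme
      \<Rightarrow> (('v decorated \<Rightarrow> 'k) set \<Rightarrow> 'v) \<Rightarrow> (('k decorated \<Rightarrow> 'k) set \<Rightarrow> 'k) \<Rightarrow> ('v \<Rightarrow> 'k)
      \<Rightarrow> (('v decorated \<Rightarrow> 'k) set \<Rightarrow> ('k decorated \<Rightarrow> 'k) set) \<Rightarrow> bool" where
  "cumulant_morphism K V \<phi>\<^sub>V \<phi>\<^sub>K E \<K> \<longleftrightarrow>
     coalgebra_map K V (scalars K) \<K> \<and>
     (\<forall>x\<in>carrier (schur K V).
        cofree_lift K (scalars K) (scalars K) \<phi>\<^sub>K (\<K> x)
          = schur_map K V (scalars K) E (cofree_lift K V V \<phi>\<^sub>V x))"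

end

theory Submission
  imports Defs
begin

text \<open>Composing the defining equation of the cumulant morphism with the counit gives
  \<open>\<phi>\<^sub>K \<circ> \<K> = E \<circ> \<phi>\<^sub>V\<close>, since the counit recovers a linear map from its adjoint coalgebra map.
  As a coalgebra map, \<open>\<K>\<close> is itself adjoint to \<open>K = \<epsilon> \<circ> \<K>\<close>; evaluated at the word
  \<open>1, 2, \<dots>, N\<close>, whose subwords are all reduced, the left-hand side is therefore the sum over the
  non-crossing partitions \<open>f\<close> of \<open>N\<close> of the products of \<open>K\<close> over the fibres of \<open>f\<close>, and
  the right-hand side is the moment \<open>E(v\<^sub>1 \<dots> v\<^sub>N)\<close>. So the values of \<open>K\<close> satisfy the
  recursion that determines the free cumulants.\<close>

section \<open>Linear maps, free modules and quotients\<close>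

text \<open>The maps on the Schur functor are built from \<open>schur_lift\<close>, a definite
  description, so none of them can be evaluated on a generator before its formula is shown to be
  multilinear and invariant under relabelling. The obstacle is the comultiplication. Its sum runs
  over surjections whose fibres are numbered by their least elements, and relabelling the letters
  disturbs that numbering: a representative composed with a relabelling has to be renumbered, and
  the renumbering is absorbed by the relabelling relation in the outer copy of the Schur functor.
  Reduction is handled through a closed form that commutes with injective maps of letters.

  In each counit law all summands but one vanish: the outer counit leaves the constant surjection,
  the inner counits leave the injective one. The second law is what turns a coalgebra map into the
  lift of its adjoint. On the scalar side the order of first occurrences disappears because
  \<open>K\<close> is commutative, so that a product over the letters of the reduced image word
  becomes a product over blocks.\<close>

lemma linear_mapsI:
  assumes "\<And>x. x \<in> carrier M \<Longrightarrow> h x \<in> carrier M'"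
    and "\<And>x y. x \<in> carrier M \<Longrightarrow> y \<in> carrier M \<Longrightarrow> h (x \<oplus>\<^bsub>M\<^esub> y) = h x \<oplus>\<^bsub>M'\<^esub> h y"
    and "\<And>c x. c \<in> carrier K \<Longrightarrow> x \<in> carrier M \<Longrightarrow> h (c \<odot>\<^bsub>M\<^esub> x) = c \<odot>\<^bsub>M'\<^esub> h x"
  shows "h \<in> linear_maps K M M'"
  using assms by (auto simp: linear_maps_def)

lemma linear_maps_closed: "h \<in> linear_maps K M M' \<Longrightarrow> x \<in> carrier M \<Longrightarrow> h x \<in> carrier M'"
  by (auto simp: linear_maps_def)

lemma linear_maps_add:
  "h \<in> linear_maps K M M' \<Longrightarrow> x \<in> carrier M \<Longrightarrow> y \<in> carrier M \<Longrightarrow> h (x \<oplus>\<^bsub>M\<^esub> y) = h x \<oplus>\<^bsub>M'\<^esub> h y"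
  by (auto simp: linear_maps_def)

lemma linear_maps_smult:
  "h \<in> linear_maps K M M' \<Longrightarrow> c \<in> carrier K \<Longrightarrow> x \<in> carrier M \<Longrightarrow> h (c \<odot>\<^bsub>M\<^esub> x) = c \<odot>\<^bsub>M'\<^esub> h x"
  by (auto simp: linear_maps_def)

lemma linear_maps_zero:
  assumes "module K M" "module K M'" "h \<in> linear_maps K M M'"
  shows "h \<zero>\<^bsub>M\<^esub> = \<zero>\<^bsub>M'\<^esub>"
proof -
  interpret M: module K M by fact
  interpret M': module K M' by fact
  have "h (\<zero>\<^bsub>K\<^esub> \<odot>\<^bsub>M\<^esub> \<zero>\<^bsub>M\<^esub>) = \<zero>\<^bsub>K\<^esub> \<odot>\<^bsub>M'\<^esub> h \<zero>\<^bsub>M\<^esub>"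
    by (rule linear_maps_smult[OF assms(3)]) auto
  then show ?thesis
    using linear_maps_closed[OF assms(3), of "\<zero>\<^bsub>M\<^esub>"] by simp
qed

lemma (in abelian_group) minus_eq_zero_iff:
  "x \<in> carrier G \<Longrightarrow> y \<in> carrier G \<Longrightarrow> x \<ominus> y = \<zero> \<longleftrightarrow> x = y"
  by (metis a_inv_closed minus_eq minus_equality minus_minus r_neg)

lemma linear_maps_minus:
  assumes "module K M" "module K M'" "h \<in> linear_maps K M M'" "x \<in> carrier M" "y \<in> carrier M"
  shows "h (x \<ominus>\<^bsub>M\<^esub> y) = h x \<ominus>\<^bsub>M'\<^esub> h y"
proof -
  interpret M: module K M by fact
  interpret M': module K M' by fact
  have neg: "h (\<ominus>\<^bsub>M\<^esub> y) = \<ominus>\<^bsub>M'\<^esub> h y"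
    using linear_maps_smult[OF assms(3), of "\<ominus>\<^bsub>K\<^esub> \<one>\<^bsub>K\<^esub>" y] assms(5)
      linear_maps_closed[OF assms(3,5)]
    by (simp add: M.smult_l_minus M'.smult_l_minus)
  show ?thesis
    using linear_maps_add[OF assms(3), of x "\<ominus>\<^bsub>M\<^esub> y"] assms(4,5) neg
    by (simp add: M.minus_eq M'.minus_eq)
qed

lemma linear_maps_finsum:
  assumes "module K M" "module K M'" "h \<in> linear_maps K M M'" "finite A" "f \<in> A \<rightarrow> carrier M"
  shows "h (\<Oplus>\<^bsub>M\<^esub> i \<in> A. f i) = (\<Oplus>\<^bsub>M'\<^esub> i \<in> A. h (f i))"
proof -
  interpret M: module K M by fact
  interpret M': module K M' by fact
  show ?thesis
    using assms(4,5)
  proof (induction A rule: finite_induct)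
    case empty
    then show ?case by (simp add: linear_maps_zero[OF assms(1-3)])
  next
    case (insert x F)
    then have "f x \<in> carrier M" "f \<in> F \<rightarrow> carrier M" by auto
    moreover have "(\<lambda>i. h (f i)) \<in> F \<rightarrow> carrier M'" "h (f x) \<in> carrier M'"
      using insert.prems linear_maps_closed[OF assms(3)] by auto
    ultimately show ?case
      using insert by (simp add: linear_maps_add[OF assms(3)])
  qed
qed

lemma linear_maps_comp:
  "g \<in> linear_maps K M M' \<Longrightarrow> h \<in> linear_maps K M' M'' \<Longrightarrow> h \<circ> g \<in> linear_maps K M M''"
  by (rule linear_mapsI) (simp_all add: linear_maps_closed linear_maps_add linear_maps_smult)

section \<open>Generated submodules and kernels\<close>

lemma submodule_generated_submodule:
  assumes "module K M" "X \<subseteq> carrier M"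
  shows "submodule (submodule_generated K M X) K M"
proof -
  interpret module K M by fact
  \<comment> \<open>The whole carrier is one of the submodules being intersected, because it
    contains \<open>X\<close>. This bounds the intersection; its closure properties are inherited
    from the members.\<close>
  have car: "submodule_generated K M X \<subseteq> carrier M"
    using carrier_is_submodule assms(2) by (auto simp: submodule_generated_def)
  show ?thesis
  proof (rule submoduleI[OF car])
    show "\<zero>\<^bsub>M\<^esub> \<in> submodule_generated K M X"
      using subgroup.one_closed[OF submodule.axioms(1)]
      by (fastforce simp: submodule_generated_def)
  qed (auto simp: submodule_generated_def submoduleE)
qed

lemma submodule_generated_superset: "X \<subseteq> submodule_generated K M X"
  by (auto simp: submodule_generated_def)

lemma submodule_generated_least:
  "submodule H K M \<Longrightarrow> X \<subseteq> H \<Longrightarrow> submodule_generated K M X \<subseteq> H"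
  by (auto simp: submodule_generated_def)

lemma submodule_kernel:
  assumes "module K M" "module K M'" "h \<in> linear_maps K M M'"
  shows "submodule {x \<in> carrier M. h x = \<zero>\<^bsub>M'\<^esub>} K M"
proof -
  interpret M: module K M by fact
  interpret M': module K M' by fact
  show ?thesis
  proof (rule M.submoduleI)
    fix a assume "a \<in> {x \<in> carrier M. h x = \<zero>\<^bsub>M'\<^esub>}"
    then show "\<ominus>\<^bsub>M\<^esub> a \<in> {x \<in> carrier M. h x = \<zero>\<^bsub>M'\<^esub>}"
      using linear_maps_minus[OF assms, of "\<zero>\<^bsub>M\<^esub>" a] linear_maps_zero[OF assms]
      by (simp add: M.minus_eq M'.minus_eq)
  qed (auto simp: linear_maps_zero[OF assms] linear_maps_add[OF assms(3)]
      linear_maps_smult[OF assms(3)])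
qed

section \<open>Free modules and their universal property\<close>

lemma module_free_module:
  fixes G :: "'g set"
  assumes "cring K"
  shows "module K (free_module K G)"
proof -
  interpret cring K by fact
  have supp: "finite {g. x g \<oplus>\<^bsub>K\<^esub> y g \<noteq> \<zero>\<^bsub>K\<^esub>} \<and> {g. x g \<oplus>\<^bsub>K\<^esub> y g \<noteq> \<zero>\<^bsub>K\<^esub>} \<subseteq> G"
    if "finite {g. x g \<noteq> \<zero>\<^bsub>K\<^esub>}" "{g. x g \<noteq> \<zero>\<^bsub>K\<^esub>} \<subseteq> G"
      "finite {g. y g \<noteq> \<zero>\<^bsub>K\<^esub>}" "{g. y g \<noteq> \<zero>\<^bsub>K\<^esub>} \<subseteq> G" for x y :: "'g \<Rightarrow> _"
  proof -
    have "{g. x g \<oplus>\<^bsub>K\<^esub> y g \<noteq> \<zero>\<^bsub>K\<^esub>} \<subseteq> {g. x g \<noteq> \<zero>\<^bsub>K\<^esub>} \<union> {g. y g \<noteq> \<zero>\<^bsub>K\<^esub>}" by auto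
    with that show ?thesis
      by (meson finite_Un finite_subset le_sup_iff order_trans)
  qed
  have supp': "finite {g. c \<otimes>\<^bsub>K\<^esub> x g \<noteq> \<zero>\<^bsub>K\<^esub>} \<and> {g. c \<otimes>\<^bsub>K\<^esub> x g \<noteq> \<zero>\<^bsub>K\<^esub>} \<subseteq> G"
    if "c \<in> carrier K" "finite {g. x g \<noteq> \<zero>\<^bsub>K\<^esub>}" "{g. x g \<noteq> \<zero>\<^bsub>K\<^esub>} \<subseteq> G" for c and x :: "'g \<Rightarrow> _"
  proof -
    have "{g. c \<otimes>\<^bsub>K\<^esub> x g \<noteq> \<zero>\<^bsub>K\<^esub>} \<subseteq> {g. x g \<noteq> \<zero>\<^bsub>K\<^esub>}" using that(1) by auto
    with that show ?thesis by (meson finite_subset order_trans)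
  qed
  have [simp]: "x g \<in> carrier K" if "range x \<subseteq> carrier K" for x :: "'g \<Rightarrow> _" and g
    using that by auto
  show ?thesis
  proof (rule moduleI)
    show "abelian_group (free_module K G)"
    proof (rule abelian_groupI)
      \<comment> \<open>The negative is formed as multiplication by minus one, so that
        \<open>supp'\<close> already supplies its finite support.\<close>
      fix x assume x: "x \<in> carrier (free_module K G)"
      then have "(\<lambda>g. (\<ominus>\<^bsub>K\<^esub> \<one>\<^bsub>K\<^esub>) \<otimes>\<^bsub>K\<^esub> x g) \<in> carrier (free_module K G)"
        using supp'[of "\<ominus>\<^bsub>K\<^esub> \<one>\<^bsub>K\<^esub>" x] by (auto simp: free_module_def)
      moreover have "(\<lambda>g. (\<ominus>\<^bsub>K\<^esub> \<one>\<^bsub>K\<^esub>) \<otimes>\<^bsub>K\<^esub> x g) \<oplus>\<^bsub>free_module K G\<^esub> x = \<zero>\<^bsub>free_module K G\<^esub>"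
        using x by (auto simp: free_module_def l_minus l_neg)
      ultimately show "\<exists>y\<in>carrier (free_module K G). y \<oplus>\<^bsub>free_module K G\<^esub> x = \<zero>\<^bsub>free_module K G\<^esub>"
        by blast
    next
      fix x y assume "x \<in> carrier (free_module K G)" "y \<in> carrier (free_module K G)"
      then show "x \<oplus>\<^bsub>free_module K G\<^esub> y \<in> carrier (free_module K G)"
        using supp[of x y] by (auto simp: free_module_def)
    qed (auto simp: free_module_def a_ac)
  next
    fix c x assume "c \<in> carrier K" "x \<in> carrier (free_module K G)"
    then show "c \<odot>\<^bsub>free_module K G\<^esub> x \<in> carrier (free_module K G)"
      using supp'[of c x] by (auto simp: free_module_def)
  qed (use assms in \<open>auto simp: free_module_def l_distr r_distr m_assoc\<close>)
qed

lemma free_gen_carrier: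
  assumes "cring K" "g \<in> G"
  shows "free_gen K g \<in> carrier (free_module K G)"
proof -
  interpret cring K by fact
  have "{g'. free_gen K g g' \<noteq> \<zero>\<^bsub>K\<^esub>} \<subseteq> {g}" by (auto simp: free_gen_def)
  then show ?thesis
    using assms(2) by (auto simp: free_module_def free_gen_def finite_subset)
qed

lemma free_module_lift_exists:
  assumes "module K W" "\<And>g. g \<in> G \<Longrightarrow> F g \<in> carrier W"
  shows "\<exists>L \<in> linear_maps K (free_module K G) W. \<forall>g\<in>G. L (free_gen K g) = F g"
proof -
  interpret W: module K W by fact
  define L where "L = (\<lambda>x. \<Oplus>\<^bsub>W\<^esub> g \<in> {g. x g \<noteq> \<zero>\<^bsub>K\<^esub>}. x g \<odot>\<^bsub>W\<^esub> F g)"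
  \<comment> \<open>The defining sum runs over a support that changes with \<open>x\<close>. To
    compare sums for different vectors, it may be extended to any finite set of generators
    containing the support; additivity uses the union of two supports.\<close>
  have L: "L x = (\<Oplus>\<^bsub>W\<^esub> g \<in> A. x g \<odot>\<^bsub>W\<^esub> F g)"
    if "finite A" "A \<subseteq> G" "{g. x g \<noteq> \<zero>\<^bsub>K\<^esub>} \<subseteq> A" "range x \<subseteq> carrier K" for A x
  proof -
    have "x g \<in> carrier K" for g using that(4) by auto
    then show ?thesis
      unfolding L_def
      by (intro W.add.finprod_mono_neutral_cong_left) (use that(1-3) assms(2) in auto)
  qed
  have car: "finite {g. x g \<noteq> \<zero>\<^bsub>K\<^esub>}" "{g. x g \<noteq> \<zero>\<^bsub>K\<^esub>} \<subseteq> G" "range x \<subseteq> carrier K"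
    if "x \<in> carrier (free_module K G)" for x
    using that by (auto simp: free_module_def)
  have "L \<in> linear_maps K (free_module K G) W"
  proof (rule linear_mapsI)
    fix x assume x: "x \<in> carrier (free_module K G)"
    note x = car[OF this]
    have xK: "x g \<in> carrier K" for g using x by auto
    show "L x \<in> carrier W"
      unfolding L_def by (rule W.finsum_closed) (use x xK assms(2) in auto)
    fix y assume y: "y \<in> carrier (free_module K G)"
    note y = car[OF this]
    let ?A = "{g. x g \<noteq> \<zero>\<^bsub>K\<^esub>} \<union> {g. y g \<noteq> \<zero>\<^bsub>K\<^esub>}"
    have A: "finite ?A" "?A \<subseteq> G" using x y by auto
    have yK: "y g \<in> carrier K" for g using y by auto
    have "L (x \<oplus>\<^bsub>free_module K G\<^esub> y) = (\<Oplus>\<^bsub>W\<^esub> g \<in> ?A. (x g \<oplus>\<^bsub>K\<^esub> y g) \<odot>\<^bsub>W\<^esub> F g)"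
    proof -
      have "L (\<lambda>g. x g \<oplus>\<^bsub>K\<^esub> y g) = (\<Oplus>\<^bsub>W\<^esub> g \<in> ?A. (x g \<oplus>\<^bsub>K\<^esub> y g) \<odot>\<^bsub>W\<^esub> F g)"
        by (rule L[OF A]) (use xK yK in auto)
      then show ?thesis by (simp add: free_module_def)
    qed
    also have "\<dots> = (\<Oplus>\<^bsub>W\<^esub> g \<in> ?A. x g \<odot>\<^bsub>W\<^esub> F g \<oplus>\<^bsub>W\<^esub> y g \<odot>\<^bsub>W\<^esub> F g)"
      by (intro W.finsum_cong') (use A(2) xK yK assms(2) in \<open>auto simp: W.smult_l_distr\<close>)
    also have "\<dots> = L x \<oplus>\<^bsub>W\<^esub> L y"
    proof -
      have "(\<lambda>g. x g \<odot>\<^bsub>W\<^esub> F g) \<in> ?A \<rightarrow> carrier W" "(\<lambda>g. y g \<odot>\<^bsub>W\<^esub> F g) \<in> ?A \<rightarrow> carrier W"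
        using A(2) xK yK assms(2) by auto
      then show ?thesis
        using L[OF A _ x(3)] L[OF A _ y(3)] by (simp add: W.finsum_addf)
    qed
    finally show "L (x \<oplus>\<^bsub>free_module K G\<^esub> y) = L x \<oplus>\<^bsub>W\<^esub> L y" .
  next
    fix c x assume c: "c \<in> carrier K" and x: "x \<in> carrier (free_module K G)"
    note x = car[OF this(2)]
    have xK: "x g \<in> carrier K" for g using x by auto
    let ?A = "{g. x g \<noteq> \<zero>\<^bsub>K\<^esub>}"
    have "L (c \<odot>\<^bsub>free_module K G\<^esub> x) = (\<Oplus>\<^bsub>W\<^esub> g \<in> ?A. (c \<otimes>\<^bsub>K\<^esub> x g) \<odot>\<^bsub>W\<^esub> F g)"
    proof -
      have "L (\<lambda>g. c \<otimes>\<^bsub>K\<^esub> x g) = (\<Oplus>\<^bsub>W\<^esub> g \<in> ?A. (c \<otimes>\<^bsub>K\<^esub> x g) \<odot>\<^bsub>W\<^esub> F g)"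
        by (rule L[OF x(1,2)]) (use xK c in auto)
      then show ?thesis by (simp add: free_module_def)
    qed
    also have "\<dots> = (\<Oplus>\<^bsub>W\<^esub> g \<in> ?A. c \<odot>\<^bsub>W\<^esub> (x g \<odot>\<^bsub>W\<^esub> F g))"
      by (intro W.finsum_cong') (use x(2) c xK assms(2) in \<open>auto simp: W.smult_assoc1\<close>)
    also have "\<dots> = c \<odot>\<^bsub>W\<^esub> L x"
      unfolding L_def using x(1,2) c xK assms(2) by (intro W.finsum_smult_ldistr[symmetric]) auto
    finally show "L (c \<odot>\<^bsub>free_module K G\<^esub> x) = c \<odot>\<^bsub>W\<^esub> L x" .
  qed
  moreover have "L (free_gen K g) = F g" if "g \<in> G" for g
  proof -
    have "L (free_gen K g) = (\<Oplus>\<^bsub>W\<^esub> g' \<in> {g}. free_gen K g g' \<odot>\<^bsub>W\<^esub> F g')"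
      by (rule L) (use that in \<open>auto simp: free_gen_def\<close>)
    then show ?thesis using that assms(2) by (simp add: free_gen_def)
  qed
  ultimately show ?thesis by blast
qed

text \<open>Induction on a finite set containing the support: subtracting the component at one
  generator \<open>g\<close> leaves a vector with smaller support, and on the removed multiple of
  \<open>free_gen K g\<close> the two maps agree by assumption.\<close>

lemma free_module_linear_maps_eqI:
  assumes "module K W" and L: "L \<in> linear_maps K (free_module K G) W"
    and L': "L' \<in> linear_maps K (free_module K G) W"
    and gen: "\<And>g. g \<in> G \<Longrightarrow> L (free_gen K g) = L' (free_gen K g)"
    and "x \<in> carrier (free_module K G)"
  shows "L x = L' x"
proof -
  interpret W: module K W by fact
  have K: "cring K" by unfold_locales
  note F = module_free_module[OF K, of G]
  interpret F: module K "free_module K G" by (rule F)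
  have "\<forall>x\<in>carrier (free_module K G). {g. x g \<noteq> \<zero>\<^bsub>K\<^esub>} \<subseteq> A \<longrightarrow> L x = L' x" if "finite A" for A
    using that
  proof (induction A rule: finite_induct)
    case empty
    have "x = \<zero>\<^bsub>free_module K G\<^esub>" if "{g. x g \<noteq> \<zero>\<^bsub>K\<^esub>} \<subseteq> {}" for x
      using that by (auto simp: free_module_def)
    then show ?case using linear_maps_zero[OF F assms(1)] L L' by metis
  next
    case (insert g A)
    show ?case
    proof (intro ballI impI)
      fix x assume x: "x \<in> carrier (free_module K G)" and sub: "{g. x g \<noteq> \<zero>\<^bsub>K\<^esub>} \<subseteq> insert g A"
      show "L x = L' x"
      proof (cases "x g = \<zero>\<^bsub>K\<^esub>")
        case True
        then show ?thesis using insert.IH x sub by auto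
      next
        case False
        define y where "y = x(g := \<zero>\<^bsub>K\<^esub>)"
        have "{h. y h \<noteq> \<zero>\<^bsub>K\<^esub>} \<subseteq> {h. x h \<noteq> \<zero>\<^bsub>K\<^esub>}" by (auto simp: y_def)
        then have y: "y \<in> carrier (free_module K G)"
          using x by (auto simp: free_module_def y_def intro: finite_subset)
        have "{h. y h \<noteq> \<zero>\<^bsub>K\<^esub>} \<subseteq> A" using sub by (auto simp: y_def)
        then have "L y = L' y" using insert.IH y by blast
        moreover have g: "g \<in> G" and xg: "x g \<in> carrier K"
          using x False by (auto simp: free_module_def)
        moreover have "x = x g \<odot>\<^bsub>free_module K G\<^esub> free_gen K g \<oplus>\<^bsub>free_module K G\<^esub> y"
        proof
          fix h
          have "x g \<in> carrier K" "x h \<in> carrier K" using x by (auto simp: free_module_def)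
          then show "x h = (x g \<odot>\<^bsub>free_module K G\<^esub> free_gen K g \<oplus>\<^bsub>free_module K G\<^esub> y) h"
            by (simp add: free_module_def y_def free_gen_def)
        qed
        moreover note free_gen_carrier[OF K g]
        ultimately show ?thesis
          using y gen[OF g] linear_maps_add[OF L] linear_maps_add[OF L'] linear_maps_smult[OF L]
            linear_maps_smult[OF L'] F.smult_closed by metis
      qed
    qed
  qed
  from this[of "{g. x g \<noteq> \<zero>\<^bsub>K\<^esub>}"] show ?thesis
    using assms(5) by (auto simp: free_module_def)
qed

section \<open>Quotient modules\<close>

context
  fixes K M H
  assumes K: "module K M" and H: "submodule H K M"
begin

interpretation module K M by (rule K)
interpretation abelian_subgroup H M
  by (intro abelian_subgroupI3 additive_subgroup.intro submodule.axioms(1)[OF H]) unfold_locales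

text \<open>The quotient defines scalar multiplication as a union over all representatives of the
  coset. Since \<open>H\<close> is closed under scalars, every representative contributes the same
  coset, and there is at least one.\<close>

lemma quotient_smult_rcos:
  assumes "c \<in> carrier K" "x \<in> carrier M"
  shows "c \<odot>\<^bsub>quotient_module M H\<^esub> (H +>\<^bsub>M\<^esub> x) = H +>\<^bsub>M\<^esub> (c \<odot>\<^bsub>M\<^esub> x)"
proof -
  have "H +>\<^bsub>M\<^esub> (c \<odot>\<^bsub>M\<^esub> y) = H +>\<^bsub>M\<^esub> (c \<odot>\<^bsub>M\<^esub> x)" if "y \<in> H +>\<^bsub>M\<^esub> x" for y
  proof -
    from that obtain h where h: "h \<in> H" "y = h \<oplus>\<^bsub>M\<^esub> x"
      by (auto simp: a_r_coset_def')
    then have "c \<odot>\<^bsub>M\<^esub> y = c \<odot>\<^bsub>M\<^esub> h \<oplus>\<^bsub>M\<^esub> c \<odot>\<^bsub>M\<^esub> x" "c \<odot>\<^bsub>M\<^esub> h \<in> H"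
      using assms submodule.smult_closed[OF H] by (auto simp: smult_r_distr)
    then have "c \<odot>\<^bsub>M\<^esub> y \<in> H +>\<^bsub>M\<^esub> (c \<odot>\<^bsub>M\<^esub> x)"
      by (auto simp: a_r_coset_def')
    then show ?thesis
      using assms a_repr_independence' by (metis smult_closed)
  qed
  then have "(\<Union>y\<in>H +>\<^bsub>M\<^esub> x. H +>\<^bsub>M\<^esub> (c \<odot>\<^bsub>M\<^esub> y)) = (\<Union>y\<in>H +>\<^bsub>M\<^esub> x. H +>\<^bsub>M\<^esub> (c \<odot>\<^bsub>M\<^esub> x))"
    by (intro SUP_cong refl)
  moreover have "H +>\<^bsub>M\<^esub> x \<noteq> {}" using a_rcos_self[OF assms(2)] by blast
  ultimately show ?thesis by (simp add: quotient_module_def)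
qed

lemma quotient_add_rcos:
  assumes "x \<in> carrier M" "y \<in> carrier M"
  shows "(H +>\<^bsub>M\<^esub> x) \<oplus>\<^bsub>quotient_module M H\<^esub> (H +>\<^bsub>M\<^esub> y) = H +>\<^bsub>M\<^esub> (x \<oplus>\<^bsub>M\<^esub> y)"
  using assms by (simp add: quotient_module_def a_rcos_sum)

lemma quotient_carrier: "carrier (quotient_module M H) = (\<lambda>x. H +>\<^bsub>M\<^esub> x) ` carrier M"
  by (auto simp: quotient_module_def A_RCOSETS_def')

lemma module_quotient_module: "module K (quotient_module M H)"
proof (rule moduleI)
  show "cring K" by unfold_locales
  show "abelian_group (quotient_module M H)"
  proof (rule abelian_groupI)
    show "\<zero>\<^bsub>quotient_module M H\<^esub> \<in> carrier (quotient_module M H)"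
      by (simp add: quotient_module_def a_subgroup_in_rcosets)
    fix x assume "x \<in> carrier (quotient_module M H)"
    then obtain a where a: "a \<in> carrier M" "x = H +>\<^bsub>M\<^esub> a" by (auto simp: quotient_carrier)
    have zero: "\<zero>\<^bsub>quotient_module M H\<^esub> = H +>\<^bsub>M\<^esub> \<zero>\<^bsub>M\<^esub>"
      using a_subset by (simp add: quotient_module_def)
    show "\<zero>\<^bsub>quotient_module M H\<^esub> \<oplus>\<^bsub>quotient_module M H\<^esub> x = x"
      using a by (simp add: zero quotient_add_rcos)
    show "\<exists>y\<in>carrier (quotient_module M H). y \<oplus>\<^bsub>quotient_module M H\<^esub> x = \<zero>\<^bsub>quotient_module M H\<^esub>"
      using a by (auto simp: quotient_carrier zero quotient_add_rcos l_neg intro!: bexI[of _ "\<ominus>\<^bsub>M\<^esub> a"])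
  qed (auto simp: quotient_carrier quotient_add_rcos a_ac)
qed (auto simp: quotient_carrier quotient_add_rcos quotient_smult_rcos smult_l_distr smult_r_distr
    smult_assoc1)

lemma quotient_rcos_linear: "(\<lambda>x. H +>\<^bsub>M\<^esub> x) \<in> linear_maps K M (quotient_module M H)"
  by (rule linear_mapsI) (auto simp: quotient_carrier quotient_add_rcos quotient_smult_rcos)

lemma quotient_rcos_eq_zero: "x \<in> H \<Longrightarrow> H +>\<^bsub>M\<^esub> x = \<zero>\<^bsub>quotient_module M H\<^esub>"
  by (simp add: a_rcos_const quotient_module_def)

lemma quotient_lift_exists:
  assumes "module K W" and L: "L \<in> linear_maps K M W" and ker: "\<And>x. x \<in> H \<Longrightarrow> L x = \<zero>\<^bsub>W\<^esub>"
  shows "\<exists>h \<in> linear_maps K (quotient_module M H) W. \<forall>x\<in>carrier M. h (H +>\<^bsub>M\<^esub> x) = L x"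
proof -
  interpret W: module K W by fact
  \<comment> \<open>An arbitrary representative serves: two of them differ by an element of
    \<open>H\<close>, where \<open>L\<close> vanishes.\<close>
  define h where "h = (\<lambda>X. L (SOME x. x \<in> X))"
  have h: "h (H +>\<^bsub>M\<^esub> x) = L x" if x: "x \<in> carrier M" for x
  proof -
    have "(SOME y. y \<in> H +>\<^bsub>M\<^esub> x) \<in> H +>\<^bsub>M\<^esub> x"
      using a_rcos_self[OF x] by (rule someI)
    then obtain y where "y \<in> H" "(SOME y. y \<in> H +>\<^bsub>M\<^esub> x) = y \<oplus>\<^bsub>M\<^esub> x"
      by (auto simp: a_r_coset_def')
    then show ?thesis
      using x ker linear_maps_closed[OF L x] by (simp add: h_def linear_maps_add[OF L])
  qed
  have "h \<in> linear_maps K (quotient_module M H) W"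
    by (rule linear_mapsI) (auto simp: quotient_carrier quotient_add_rcos quotient_smult_rcos h
        linear_maps_closed[OF L] linear_maps_add[OF L] linear_maps_smult[OF L])
  with h show ?thesis by blast
qed

end


section \<open>Reduction of words\<close>

lemma subseq_remdups_adj: "subseq (remdups_adj w) w"
  by (induction w rule: remdups_adj.induct) auto

lemma remdups_adj_map_inj_on:
  "inj_on \<sigma> (set w) \<Longrightarrow> remdups_adj (map \<sigma> w) = map \<sigma> (remdups_adj w)"
  by (induction w rule: remdups_adj.induct) (auto simp: inj_on_def)

text \<open>Closed form of the reduction. One cut at the end is enough: once adjacent repetitions
  are merged, the letter before the last differs from the last one, hence from the first whenever a
  cut takes place.\<close>

definition cyclic_remdups_adj :: "'a list \<Rightarrow> 'a list" where
  "cyclic_remdups_adj w =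
     (let u = remdups_adj w in if length u > 1 \<and> hd u = last u then butlast u else u)"

lemma hd_last_decomp:
  assumes "length u > 1" "hd u = last u"
  obtains a m where "u = a # m @ [a]"
proof -
  from assms(1) obtain a v where u: "u = a # v" "v \<noteq> []" by (cases u) auto
  then have "u = a # butlast v @ [a]"
    using assms(2) append_butlast_last_id[of v] by simp
  then show thesis by (rule that)
qed

text \<open>Merging two equal neighbours is invisible to \<open>remdups_adj\<close>. Deleting a last
  letter equal to the first is either such a merge or removes precisely the letter that the closed
  form cuts off.\<close>

lemma cyclic_remdups_adj_reduce_step:
  assumes "reduce_step w u"
  shows "cyclic_remdups_adj w = cyclic_remdups_adj u"
  using assms
proof cases
  case (adjacent p a q)
  then show ?thesis
    using remdups_adj_append[of p a "a # q"] remdups_adj_append[of p a q]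
    by (simp add: cyclic_remdups_adj_def)
next
  case (ends a m)
  have snoc: "remdups_adj (a # m @ [a]) =
      remdups_adj (a # m) @ (if last (a # m) = a then [] else [a])"
    using remdups_adj_append''[of "a # m" "[a]"] by auto
  show ?thesis
  proof (cases "last (a # m) = a")
    case True
    then show ?thesis using ends snoc by (simp add: cyclic_remdups_adj_def)
  next
    case False
    have "hd (remdups_adj (a # m)) = a" "last (remdups_adj (a # m)) \<noteq> a"
      using False by simp_all
    then show ?thesis
      using ends snoc False by (auto simp: cyclic_remdups_adj_def Let_def hd_append)
  qed
qed

text \<open>The prefix \<open>p\<close> collects the letters already passed by the recursion. Only
  \<open>adjacent\<close> steps occur, and these remain possible behind any prefix, whereas an
  \<open>ends\<close> step would not.\<close>

lemma reduce_steps_remdups_adj: "reduce_step\<^sup>*\<^sup>* (p @ w) (p @ remdups_adj w)"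
proof (induction w arbitrary: p rule: remdups_adj.induct)
  case (3 x y w)
  show ?case
  proof (cases "x = y")
    case True
    have "reduce_step (p @ x # y # w) (p @ x # w)"
      using reduce_step.adjacent[of p x w] True by simp
    then show ?thesis using 3(1)[OF True, of p] True by (simp add: converse_rtranclp_into_rtranclp)
  next
    case False
    then show ?thesis using 3(2)[of "p @ [x]"] by simp
  qed
qed auto

lemma reduce_steps_cyclic_remdups_adj: "reduce_step\<^sup>*\<^sup>* w (cyclic_remdups_adj w)"
proof (cases "length (remdups_adj w) > 1 \<and> hd (remdups_adj w) = last (remdups_adj w)")
  case True
  then obtain a m where m: "remdups_adj w = a # m @ [a]" by (elim conjE hd_last_decomp)
  moreover have "reduce_step (a # m @ [a]) (a # m)" by (rule reduce_step.ends)
  ultimately show ?thesis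
    using reduce_steps_remdups_adj[of "[]" w] True
    by (auto simp: cyclic_remdups_adj_def butlast_append intro: rtranclp.rtrancl_into_rtrancl)
next
  case False
  then show ?thesis
    using reduce_steps_remdups_adj[of "[]" w] by (auto simp: cyclic_remdups_adj_def Let_def)
qed

lemma length_cyclic_remdups_adj: "length (cyclic_remdups_adj w) \<le> length w"
  by (auto simp: cyclic_remdups_adj_def Let_def intro: order_trans[OF diff_le_self])

text \<open>A cut would shorten the word strictly, so equal length leaves only the branch
  \<open>remdups_adj w\<close>, and \<open>remdups_adj\<close> keeps the length only if there is
  nothing to merge.\<close>

lemma cyclic_remdups_adj_eq_self:
  assumes "length (cyclic_remdups_adj w) = length w"
  shows "cyclic_remdups_adj w = w"
proof -
  have "length (butlast (remdups_adj w)) < length w" if "length (remdups_adj w) > 1"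
    by (rule less_le_trans[OF _ remdups_adj_length]) (use that in auto)
  moreover have "cyclic_remdups_adj w = remdups_adj w \<or>
      length (remdups_adj w) > 1 \<and> cyclic_remdups_adj w = butlast (remdups_adj w)"
    by (simp add: cyclic_remdups_adj_def Let_def)
  ultimately have "cyclic_remdups_adj w = remdups_adj w"
    using assms by auto
  then show ?thesis
    using assms by (metis distinct_adj_altdef distinct_adj_conv_length_remdups_adj)
qed

text \<open>The normal form is an invariant of the steps, so that a reduct of minimal length is
  its own normal form.\<close>

lemma reduction_eq: "reduction w = cyclic_remdups_adj w"
  unfolding reduction_def
proof (rule the_equality)
  have inv: "cyclic_remdups_adj u = cyclic_remdups_adj w" if "reduce_step\<^sup>*\<^sup>* w u" for u
    using that by (induction rule: rtranclp_induct) (auto dest: cyclic_remdups_adj_reduce_step)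
  show "reduce_step\<^sup>*\<^sup>* w (cyclic_remdups_adj w) \<and>
      (\<forall>u. reduce_step\<^sup>*\<^sup>* w u \<longrightarrow> length (cyclic_remdups_adj w) \<le> length u)"
    using reduce_steps_cyclic_remdups_adj inv length_cyclic_remdups_adj by metis
  fix u assume u: "reduce_step\<^sup>*\<^sup>* w u \<and> (\<forall>u'. reduce_step\<^sup>*\<^sup>* w u' \<longrightarrow> length u \<le> length u')"
  then have eq: "cyclic_remdups_adj u = cyclic_remdups_adj w" by (blast intro: inv)
  then have "length u \<le> length (cyclic_remdups_adj u)"
    using u reduce_steps_cyclic_remdups_adj by metis
  then have "cyclic_remdups_adj u = u"
    using length_cyclic_remdups_adj[of u] by (intro cyclic_remdups_adj_eq_self) simp
  then show "u = cyclic_remdups_adj w" using eq by simp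
qed

lemma reduction_eq_Nil_iff [simp]: "reduction w = [] \<longleftrightarrow> w = []"
proof -
  have "butlast u \<noteq> []" if "length u > 1" for u :: "'a list"
    using that by (cases u) auto
  then show ?thesis by (auto simp: reduction_eq cyclic_remdups_adj_def Let_def)
qed

text \<open>A letter is deleted only while another occurrence of it survives, next to it or at the
  front.\<close>

lemma set_reduction [simp]: "set (reduction w) = set w"
proof (cases "length (remdups_adj w) > 1 \<and> hd (remdups_adj w) = last (remdups_adj w)")
  case True
  then obtain a m where m: "remdups_adj w = a # m @ [a]" by (elim conjE hd_last_decomp)
  then have "reduction w = a # m"
    using True by (simp add: reduction_eq cyclic_remdups_adj_def butlast_append)
  moreover have "set (remdups_adj w) = set (a # m)" using m by auto
  ultimately show ?thesis by simp
next
  case False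
  then show ?thesis by (auto simp: reduction_eq cyclic_remdups_adj_def Let_def)
qed

lemma subseq_reduction: "subseq (reduction w) w"
proof -
  have "subseq (butlast u) u" for u :: "'a list"
    by (rule prefix_imp_subseq) (simp add: prefixeq_butlast)
  then show ?thesis
    using subseq_remdups_adj[of w] subseq_order.order_trans
    by (auto simp: reduction_eq cyclic_remdups_adj_def Let_def)
qed

lemma reduced_reduction:
  assumes "w \<noteq> []"
  shows "reduced (reduction w)"
proof (cases "length (remdups_adj w) > 1 \<and> hd (remdups_adj w) = last (remdups_adj w)")
  case True
  then obtain a m where m: "remdups_adj w = a # m @ [a]" by (elim conjE hd_last_decomp)
  then have red: "reduction w = a # m"
    using True by (simp add: reduction_eq cyclic_remdups_adj_def butlast_append)
  \<comment> \<open>The letter before the final \<open>a\<close> is not \<open>a\<close>, so the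
    word after the cut cannot again begin and end with the same letter.\<close>
  have adj: "distinct_adj (a # m @ [a])" using m distinct_adj_remdups_adj[of w] by simp
  then have "distinct_adj ((a # m) @ [a])" by simp
  then have "distinct_adj (a # m)" "last (a # m) \<noteq> a"
    unfolding distinct_adj_append_iff by auto
  then show ?thesis by (auto simp: red reduced_def)
next
  case False
  then have red: "reduction w = remdups_adj w"
    by (auto simp: reduction_eq cyclic_remdups_adj_def Let_def)
  have "length (remdups_adj w) \<ge> 1" using assms by (simp add: Suc_le_eq)
  then show ?thesis using False by (auto simp: red reduced_def)
qed

lemma reduction_reduced: "reduced w \<Longrightarrow> reduction w = w"
  by (auto simp: reduction_eq cyclic_remdups_adj_def reduced_def distinct_adj_altdef Let_def)

text \<open>The closed form only tests letters for equality, and an injective map preserves and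
  reflects these tests.\<close>

lemma reduction_map:
  assumes "inj_on \<sigma> (set w)"
  shows "reduction (map \<sigma> w) = map \<sigma> (reduction w)"
proof (cases "w = []")
  case False
  then have "hd (remdups_adj w) \<in> set w" "last (remdups_adj w) \<in> set w"
    by auto
  then have "\<sigma> (hd (remdups_adj w)) = \<sigma> (last (remdups_adj w)) \<longleftrightarrow>
      hd (remdups_adj w) = last (remdups_adj w)"
    using assms by (auto simp: inj_on_def)
  then show ?thesis
    using False remdups_adj_map_inj_on[OF assms]
    by (auto simp: reduction_eq cyclic_remdups_adj_def Let_def map_butlast hd_map last_map)
qed (auto simp: reduction_eq cyclic_remdups_adj_def)

section \<open>Crossings, first occurrences and basis words\<close>

lemma subseq_imp_set_subset: "subseq u w \<Longrightarrow> set u \<subseteq> set w"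
  by (metis set_nths_subset subseq_conv_nths)

lemma crossing_subseq: "subseq u w \<Longrightarrow> crossing u \<Longrightarrow> crossing w"
  unfolding crossing_def by (meson subseq_order.order_trans)

lemma crossing_mapI:
  assumes "inj_on \<sigma> (set w)" "crossing w"
  shows "crossing (map \<sigma> w)"
proof -
  obtain a b where ab: "a \<noteq> b" "subseq [a, b, a, b] w"
    using assms(2) by (auto simp: crossing_def)
  have "set [a, b, a, b] \<subseteq> set w"
    by (rule subseq_imp_set_subset[OF ab(2)])
  then have "\<sigma> a \<noteq> \<sigma> b" using assms(1) ab(1) by (auto simp: inj_on_def)
  moreover have "subseq [\<sigma> a, \<sigma> b, \<sigma> a, \<sigma> b] (map \<sigma> w)"
    using subseq_map[OF ab(2), of \<sigma>] by simp
  ultimately show ?thesis by (auto simp: crossing_def)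
qed

lemma crossing_map_iff:
  assumes "inj_on \<sigma> (set w)"
  shows "crossing (map \<sigma> w) \<longleftrightarrow> crossing w"
proof
  assume "crossing (map \<sigma> w)"
  then have "crossing (map (inv_into (set w) \<sigma>) (map \<sigma> w))"
    by (rule crossing_mapI[rotated]) (auto intro: inj_on_inv_into)
  moreover have "map (inv_into (set w) \<sigma>) (map \<sigma> w) = w"
    using assms by (auto intro: map_idI)
  ultimately show "crossing w" by simp
qed (rule crossing_mapI[OF assms])

lemma remdups_map_inj_on: "inj_on \<sigma> (set w) \<Longrightarrow> remdups (map \<sigma> w) = map \<sigma> (remdups w)"
  by (induction w) (auto simp: inj_on_def)

lemma first_occurrences_map:
  "inj_on \<sigma> (set w) \<Longrightarrow> first_occurrences (map \<sigma> w) = map \<sigma> (first_occurrences w)"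
  by (simp add: first_occurrences_def rev_map remdups_map_inj_on)

lemma set_first_occurrences [simp]: "set (first_occurrences w) = set w"
  by (simp add: first_occurrences_def)

lemma distinct_first_occurrences [simp]: "distinct (first_occurrences w)"
  by (simp add: first_occurrences_def)

lemma first_occurrences_distinct: "distinct w \<Longrightarrow> first_occurrences w = w"
  by (simp add: first_occurrences_def distinct_remdups_id)

lemma reduction_in_nc_words:
  "w \<noteq> [] \<Longrightarrow> \<not> crossing w \<Longrightarrow> reduction w \<in> nc_words (set w)"
  using crossing_subseq[OF subseq_reduction] by (auto simp: nc_words_def reduced_reduction)

text \<open>Provides the inner factors of the decomposition map: deleting letters cannot create a
  crossing, and the letter \<open>x\<close> keeps the remaining word nonempty.\<close>

lemma reduction_filter_in_nc_words:
  assumes "\<not> crossing w" "x \<in> set w" "P x"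
  shows "reduction (filter P w) \<in> nc_words {x \<in> set w. P x}"
  using reduction_in_nc_words[of "filter P w"] crossing_subseq[OF subseq_filter_left, of P w] assms
  by (auto simp: filter_empty_conv)

lemma nc_words_map:
  assumes "inj_on \<sigma> (set w)" "w \<in> nc_words (set w)"
  shows "map \<sigma> w \<in> nc_words (set (map \<sigma> w))"
proof -
  have "hd w \<in> set w \<and> last w \<in> set w" using assms(2) by (auto simp: nc_words_def)
  then have "\<sigma> (hd w) = \<sigma> (last w) \<longleftrightarrow> hd w = last w"
    using assms(1) by (auto simp: inj_on_def)
  then show ?thesis
    using assms distinct_adj_mapI
    by (auto simp: nc_words_def reduced_def crossing_map_iff hd_map last_map)
qed

lemma distinct_imp_not_crossing:
  assumes "distinct w"
  shows "\<not> crossing w"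
proof
  assume "crossing w"
  then obtain a b where "subseq [a, b, a, b] w" by (auto simp: crossing_def)
  then have "distinct [a, b, a, b]"
    using assms by (metis subseq_conv_nths distinct_nthsI)
  then show False by simp
qed

text \<open>Covers the words 1, ..., N and all their nonempty restrictions; these are the words on
  which the cumulants are read off.\<close>

lemma distinct_in_nc_words:
  assumes "distinct w" "w \<noteq> []"
  shows "w \<in> nc_words (set w)"
proof -
  have "length w = 1 \<or> hd w \<noteq> last w"
    using assms by (cases w) auto
  then show ?thesis
    using assms distinct_imp_not_crossing[OF assms(1)]
    by (simp add: nc_words_def reduced_def distinct_adj_altdef remdups_adj_distinct)
qed


section \<open>Representatives of surjections\<close>

definition fibre_min :: "nat set \<Rightarrow> (nat \<Rightarrow> 'a) \<Rightarrow> nat \<Rightarrow> nat" where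
  "fibre_min S f s = Min {s' \<in> S. f s' = f s}"

text \<open>The rank of the fibre of \<open>s\<close> when the fibres are ordered by least element.
  The fibre counts itself, so ranks begin at 1, as \<open>surj_reps\<close> demands. The values of
  \<open>f\<close> may lie in any type, as only its fibres enter.\<close>

definition canonical_rep :: "nat set \<Rightarrow> (nat \<Rightarrow> 'a) \<Rightarrow> nat \<Rightarrow> nat" where
  "canonical_rep S f = (\<lambda>s\<in>S. card {m \<in> fibre_min S f ` S. m \<le> fibre_min S f s})"

lemma fibre_min:
  assumes "finite S" "s \<in> S"
  shows "fibre_min S f s \<in> S" "f (fibre_min S f s) = f s"
  using Min_in[of "{s' \<in> S. f s' = f s}"] assms by (auto simp: fibre_min_def)

lemma fibre_min_eq_iff:
  assumes "finite S" "s \<in> S" "s' \<in> S"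
  shows "fibre_min S f s = fibre_min S f s' \<longleftrightarrow> f s = f s'"
  using fibre_min(2)[OF assms(1,2), of f] fibre_min(2)[OF assms(1,3), of f]
  by (metis fibre_min_def)

lemma card_initial_le_iff:
  fixes m m' :: nat
  assumes "finite A" "m \<in> A" "m' \<in> A"
  shows "card {x \<in> A. x \<le> m} < card {x \<in> A. x \<le> m'} \<longleftrightarrow> m < m'"
proof -
  have "card {x \<in> A. x \<le> n} < card {x \<in> A. x \<le> n'}" if "n < n'" "n' \<in> A" for n n'
  proof (rule psubset_card_mono)
    have "n' \<in> {x \<in> A. x \<le> n'}" "n' \<notin> {x \<in> A. x \<le> n}" using that by auto
    moreover have "{x \<in> A. x \<le> n} \<subseteq> {x \<in> A. x \<le> n'}" using that(1) by auto
    ultimately show "{x \<in> A. x \<le> n} \<subset> {x \<in> A. x \<le> n'}" by blast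
  qed (use assms(1) in simp)
  moreover have "card {x \<in> A. x \<le> n} \<le> card {x \<in> A. x \<le> n'}" if "n \<le> n'" for n n'
    using that assms(1) by (intro card_mono) auto
  ultimately show ?thesis using assms by (metis not_le)
qed

text \<open>The ranks are distinct and bounded by the size of the set, so by counting they leave no
  gap.\<close>

lemma card_initial_image:
  fixes A :: "nat set"
  assumes "finite A"
  shows "(\<lambda>m. card {x \<in> A. x \<le> m}) ` A = {1..card A}"
proof (rule card_subset_eq)
  have "card {x \<in> A. x \<le> m} \<ge> 1" if "m \<in> A" for m
    using that assms by (auto simp: Suc_le_eq card_gt_0_iff)
  then show "(\<lambda>m. card {x \<in> A. x \<le> m}) ` A \<subseteq> {1..card A}"
    using assms by (auto intro: card_mono)
  have "inj_on (\<lambda>m. card {x \<in> A. x \<le> m}) A"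
  proof (rule inj_onI)
    fix m m' assume "m \<in> A" "m' \<in> A" "card {x \<in> A. x \<le> m} = card {x \<in> A. x \<le> m'}"
    then show "m = m'"
      using card_initial_le_iff[OF assms, of m m'] card_initial_le_iff[OF assms, of m' m] by simp
  qed
  then show "card ((\<lambda>m. card {x \<in> A. x \<le> m}) ` A) = card {1..card A}"
    by (simp add: card_image)
qed simp

lemma canonical_rep_less_iff:
  assumes "finite S" "s \<in> S" "s' \<in> S"
  shows "canonical_rep S f s < canonical_rep S f s' \<longleftrightarrow> fibre_min S f s < fibre_min S f s'"
  using assms by (simp add: canonical_rep_def card_initial_le_iff)

lemma canonical_rep_eq_iff:
  assumes "finite S" "s \<in> S" "s' \<in> S"
  shows "canonical_rep S f s = canonical_rep S f s' \<longleftrightarrow> f s = f s'"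
  using canonical_rep_less_iff[OF assms] canonical_rep_less_iff[OF assms(1,3,2)]
    fibre_min_eq_iff[OF assms] by (metis nat_neq_iff)

text \<open>Least elements of fibres are determined by the fibres alone. Hence the representative is
  an invariant of the isomorphism class of a surjection under \<open>S\<close>.\<close>

lemma canonical_rep_cong:
  assumes "\<And>s s'. s \<in> S \<Longrightarrow> s' \<in> S \<Longrightarrow> f s = f s' \<longleftrightarrow> g s = g s'"
  shows "canonical_rep S f = canonical_rep S g"
proof -
  have "fibre_min S f s = fibre_min S g s" if "s \<in> S" for s
    using assms that unfolding fibre_min_def by (metis (mono_tags, lifting))
  then show ?thesis by (auto simp: canonical_rep_def restrict_def cong: image_cong)
qed

lemma canonical_rep_in_surj_reps:
  assumes "finite S"
  shows "canonical_rep S f \<in> surj_reps S"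
proof -
  let ?M = "fibre_min S f ` S"
  have "canonical_rep S f ` S = (\<lambda>m. card {x \<in> ?M. x \<le> m}) ` ?M"
    by (auto simp: canonical_rep_def)
  then have img: "canonical_rep S f ` S = {1..card ?M}"
    using card_initial_image[of ?M] assms by simp
  \<comment> \<open>The representative has the same fibres as \<open>f\<close>, hence the same least
    elements.\<close>
  have min: "Min {s' \<in> S. canonical_rep S f s' = canonical_rep S f s} = fibre_min S f s" if "s \<in> S" for s
    using canonical_rep_eq_iff[OF assms _ that, of _ f]
    unfolding fibre_min_def by (metis (mono_tags, lifting))
  have "Min {s \<in> S. canonical_rep S f s = i} < Min {s \<in> S. canonical_rep S f s = j}"
    if "i \<in> {1..card ?M}" "j \<in> {1..card ?M}" "i < j" for i j
  proof -
    from that(1,2) img obtain s s' where s: "s \<in> S" "s' \<in> S"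
      and ij: "i = canonical_rep S f s" "j = canonical_rep S f s'"
      by (metis imageE)
    show ?thesis
      using that(3) unfolding ij min[OF s(1)] min[OF s(2)] canonical_rep_less_iff[OF assms s] .
  qed
  moreover have "canonical_rep S f \<in> extensional S" by (simp add: canonical_rep_def)
  ultimately show ?thesis using img unfolding surj_reps_def by blast
qed

text \<open>In \<open>surj_reps\<close> the least elements increase with the label, so the fibre
  labelled \<open>i\<close> has rank \<open>i\<close>. Two representatives with the same fibres are
  therefore equal.\<close>

lemma canonical_rep_surj_rep:
  assumes "finite S" "f \<in> surj_reps S"
  shows "canonical_rep S f = f"
proof
  fix s
  obtain k where k: "f ` S = {1..k}" and mono: "\<forall>i\<in>{1..k}. \<forall>j\<in>{1..k}. i < j \<longrightarrow>
      Min {s \<in> S. f s = i} < Min {s \<in> S. f s = j}" and ext: "f \<in> extensional S"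
    using assms(2) unfolding surj_reps_def by blast
  show "canonical_rep S f s = f s"
  proof (cases "s \<in> S")
    case True
    let ?m = "\<lambda>i. Min {s \<in> S. f s = i}"
    have le: "?m i \<le> ?m j \<longleftrightarrow> i \<le> j" if "i \<in> {1..k}" "j \<in> {1..k}" for i j
    proof -
      have "?m i < ?m j" if "i < j" using mono \<open>i \<in> {1..k}\<close> \<open>j \<in> {1..k}\<close> that by blast
      moreover have "?m j < ?m i" if "j < i" using mono \<open>i \<in> {1..k}\<close> \<open>j \<in> {1..k}\<close> that by blast
      ultimately show ?thesis by (cases i j rule: linorder_cases) auto
    qed
    have inj: "inj_on ?m {1..k}"
    proof (rule inj_onI)
      fix i j assume "i \<in> {1..k}" "j \<in> {1..k}" "?m i = ?m j"
      then show "i = j" using le[of i j] le[of j i] by simp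
    qed
    have fs: "f s \<in> {1..k}" using True k by blast
    have "fibre_min S f ` S = ?m ` {1..k}" unfolding k[symmetric] image_image by (simp add: fibre_min_def)
    then have "{m \<in> fibre_min S f ` S. m \<le> fibre_min S f s} = ?m ` {i \<in> {1..k}. i \<le> f s}"
      using le fs by (auto simp: fibre_min_def)
    also have "{i \<in> {1..k}. i \<le> f s} = {1..f s}" using fs by auto
    also have "card (?m ` {1..f s}) = f s"
      using inj fs by (subst card_image) (auto intro: inj_on_subset)
    finally show ?thesis using True by (simp add: canonical_rep_def)
  next
    case False
    then show ?thesis using ext by (simp add: canonical_rep_def extensional_def)
  qed
qed

lemma finite_surj_reps:
  assumes "finite S"
  shows "finite (surj_reps S)"
proof (rule finite_subset)
  show "surj_reps S \<subseteq> S \<rightarrow>\<^sub>E {1..card S}"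
  proof
    fix f assume "f \<in> surj_reps S"
    then obtain k where "f ` S = {1..k}" "f \<in> extensional S" by (auto simp: surj_reps_def)
    moreover from this have "k \<le> card S" using card_image_le[OF assms, of f] by simp
    ultimately have "f s \<in> {1..card S}" if "s \<in> S" for s
      using that by (metis atLeastAtMost_iff imageI order_trans)
    then show "f \<in> S \<rightarrow>\<^sub>E {1..card S}" using \<open>f \<in> extensional S\<close> by (auto simp: PiE_def)
  qed
  show "finite (S \<rightarrow>\<^sub>E {1..card S})" using assms by (intro finite_PiE) auto
qed

text \<open>Since \<open>\<sigma>\<close> need not be monotone, composing with it may spoil the
  order of the least elements, so each composite is renumbered. Going forth and back restores the
  original fibres, and these determine the representative.\<close>

lemma bij_betw_surj_reps:
  assumes "finite S" "inj_on \<sigma> S"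
  shows "bij_betw (\<lambda>f. canonical_rep S (f \<circ> \<sigma>)) (surj_reps (\<sigma> ` S)) (surj_reps S)"
proof (rule bij_betw_byWitness[where f' = "\<lambda>g. canonical_rep (\<sigma> ` S) (g \<circ> inv_into S \<sigma>)"])
  have fin: "finite (\<sigma> ` S)" using assms(1) by simp
  have inv: "inv_into S \<sigma> (\<sigma> s) = s" if "s \<in> S" for s using that assms(2) by simp
  show "\<forall>f\<in>surj_reps (\<sigma> ` S). canonical_rep (\<sigma> ` S) (canonical_rep S (f \<circ> \<sigma>) \<circ> inv_into S \<sigma>) = f"
  proof
    fix f assume f: "f \<in> surj_reps (\<sigma> ` S)"
    have "canonical_rep (\<sigma> ` S) (canonical_rep S (f \<circ> \<sigma>) \<circ> inv_into S \<sigma>) = canonical_rep (\<sigma> ` S) f"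
      by (rule canonical_rep_cong) (auto simp: inv canonical_rep_eq_iff[OF assms(1)])
    then show "canonical_rep (\<sigma> ` S) (canonical_rep S (f \<circ> \<sigma>) \<circ> inv_into S \<sigma>) = f"
      by (simp add: canonical_rep_surj_rep[OF fin f])
  qed
  show "\<forall>g\<in>surj_reps S. canonical_rep S (canonical_rep (\<sigma> ` S) (g \<circ> inv_into S \<sigma>) \<circ> \<sigma>) = g"
  proof
    fix g assume g: "g \<in> surj_reps S"
    have "canonical_rep S (canonical_rep (\<sigma> ` S) (g \<circ> inv_into S \<sigma>) \<circ> \<sigma>) = canonical_rep S g"
      by (rule canonical_rep_cong) (auto simp: inv canonical_rep_eq_iff[OF fin])
    then show "canonical_rep S (canonical_rep (\<sigma> ` S) (g \<circ> inv_into S \<sigma>) \<circ> \<sigma>) = g"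
      by (simp add: canonical_rep_surj_rep[OF assms(1) g])
  qed
qed (auto intro!: canonical_rep_in_surj_reps simp: assms(1))

text \<open>Passing to the representative is an injective renaming of the values of
  \<open>f\<close>. Applied to the word \<open>map f w\<close> it becomes a relabelling, under which
  crossings, reductions and classes behave well.\<close>

lemma canonical_rep_factor:
  assumes "finite S"
  obtains \<tau> where "inj_on \<tau> (f ` S)" "\<And>s. s \<in> S \<Longrightarrow> canonical_rep S f s = \<tau> (f s)"
proof
  \<comment> \<open>Any preimage of \<open>t\<close> will do, since the rank is constant on
    fibres.\<close>
  define \<tau> where "\<tau> = (\<lambda>t. canonical_rep S f (inv_into S f t))"
  show eq: "canonical_rep S f s = \<tau> (f s)" if "s \<in> S" for s
  proof -
    have "inv_into S f (f s) \<in> S" "f (inv_into S f (f s)) = f s"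
      using that by (auto simp: inv_into_into f_inv_into_f)
    then show ?thesis using canonical_rep_eq_iff[OF assms that, of _ f] by (simp add: \<tau>_def)
  qed
  show "inj_on \<tau> (f ` S)"
    by (auto simp: inj_on_def eq[symmetric] canonical_rep_eq_iff[OF assms])
qed


section \<open>Linear maps out of the Schur functor\<close>

lemma nc_words_map_iff:
  assumes "inj_on \<sigma> (set w)"
  shows "map \<sigma> w \<in> nc_words (set (map \<sigma> w)) \<longleftrightarrow> w \<in> nc_words (set w)"
proof
  assume *: "map \<sigma> w \<in> nc_words (set (map \<sigma> w))"
  have "map (inv_into (set w) \<sigma>) (map \<sigma> w) = w"
    using assms by (auto intro: map_idI)
  moreover have "inj_on (inv_into (set w) \<sigma>) (set (map \<sigma> w))"
    by (auto intro: inj_on_inv_into)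
  ultimately show "w \<in> nc_words (set w)" using nc_words_map[OF _ *] by metis
qed (rule nc_words_map[OF assms])

lemma decorated_wordsI:
  "w \<in> nc_words (set w) \<Longrightarrow> z \<in> set w \<rightarrow> carrier V \<Longrightarrow> (w, restrict z (set w)) \<in> decorated_words V"
  by (auto simp: decorated_words_def)

lemma decorated_words_upd:
  "(w, z) \<in> decorated_words V \<Longrightarrow> s \<in> set w \<Longrightarrow> a \<in> carrier V \<Longrightarrow> (w, z(s := a)) \<in> decorated_words V"
  by (auto simp: decorated_words_def PiE_def extensional_def)

lemma decorated_words_relabel:
  assumes "inj_on \<sigma> (set w)" "(map \<sigma> w, z) \<in> decorated_words V"
  shows "(w, restrict (z \<circ> \<sigma>) (set w)) \<in> decorated_words V"
  using assms nc_words_map_iff[OF assms(1)] by (auto simp: decorated_words_def)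

text \<open>Beyond closure, one clause for each kind of generator of \<open>schur_relations\<close>;
  together they let \<open>F\<close> descend to the quotient. Only extensional decorations are
  tested, which is why the last clause restricts \<open>z \<circ> \<sigma>\<close>.\<close>

definition schur_compatible ::
    "('k, 'm) ring_scheme \<Rightarrow> ('k, 'v, 'x) module_scheme \<Rightarrow> ('k, 'w, 'y) module_scheme
      \<Rightarrow> (nat list \<Rightarrow> (nat \<Rightarrow> 'v) \<Rightarrow> 'w) \<Rightarrow> bool" where
  "schur_compatible K V W F \<longleftrightarrow>
     (\<forall>w z. (w, z) \<in> decorated_words V \<longrightarrow> F w z \<in> carrier W \<and>
       (\<forall>s\<in>set w. \<forall>a\<in>carrier V. \<forall>b\<in>carrier V.
          F w (z(s := a \<oplus>\<^bsub>V\<^esub> b)) = F w (z(s := a)) \<oplus>\<^bsub>W\<^esub> F w (z(s := b))) \<and>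
       (\<forall>s\<in>set w. \<forall>c\<in>carrier K. \<forall>a\<in>carrier V.
          F w (z(s := c \<odot>\<^bsub>V\<^esub> a)) = c \<odot>\<^bsub>W\<^esub> F w (z(s := a)))) \<and>
     (\<forall>w z \<sigma>. inj_on \<sigma> (set w) \<longrightarrow> (map \<sigma> w, z) \<in> decorated_words V \<longrightarrow>
        F (map \<sigma> w) z = F w (restrict (z \<circ> \<sigma>) (set w)))"

lemma schur_compatibleI:
  assumes "\<And>w z. (w, z) \<in> decorated_words V \<Longrightarrow> F w z \<in> carrier W"
    and "\<And>w z s a b. (w, z) \<in> decorated_words V \<Longrightarrow> s \<in> set w \<Longrightarrow> a \<in> carrier V \<Longrightarrow> b \<in> carrier V \<Longrightarrow>
      F w (z(s := a \<oplus>\<^bsub>V\<^esub> b)) = F w (z(s := a)) \<oplus>\<^bsub>W\<^esub> F w (z(s := b))"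
    and "\<And>w z s c a. (w, z) \<in> decorated_words V \<Longrightarrow> s \<in> set w \<Longrightarrow> c \<in> carrier K \<Longrightarrow> a \<in> carrier V \<Longrightarrow>
      F w (z(s := c \<odot>\<^bsub>V\<^esub> a)) = c \<odot>\<^bsub>W\<^esub> F w (z(s := a))"
    and "\<And>w z \<sigma>. inj_on \<sigma> (set w) \<Longrightarrow> (map \<sigma> w, z) \<in> decorated_words V \<Longrightarrow>
      F (map \<sigma> w) z = F w (restrict (z \<circ> \<sigma>) (set w))"
  shows "schur_compatible K V W F"
  using assms unfolding schur_compatible_def by blast

section \<open>The Schur functor as a quotient of a free module\<close>

context
  fixes K :: "('k, 'm) ring_scheme" and V :: "('k, 'v, 'x) module_scheme"
  assumes V: "module K V"
begin

interpretation V: module K V by (rule V)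
interpretation free: module K "free_decorated K V"
  by (rule module_free_module) unfold_locales

lemma free_gen_decorated:
  "wz \<in> decorated_words V \<Longrightarrow> free_gen K wz \<in> carrier (free_decorated K V)"
  by (rule free_gen_carrier) unfold_locales

lemma schur_relations_subset: "schur_relations K V \<subseteq> carrier (free_decorated K V)"
proof
  fix x assume "x \<in> schur_relations K V"
  then show "x \<in> carrier (free_decorated K V)"
    by cases (auto intro!: free.minus_closed free.a_closed free.smult_closed free_gen_decorated
        decorated_words_upd decorated_words_relabel)
qed

lemma submodule_schur_null: "submodule (schur_null K V) K (free_decorated K V)"
  by (rule submodule_generated_submodule[OF free.module_axioms schur_relations_subset])

lemma module_schur: "module K (schur K V)"
  unfolding schur_def by (rule module_quotient_module[OF free.module_axioms submodule_schur_null])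

interpretation schur: module K "schur K V" by (rule module_schur)

abbreviation schur_proj where
  "schur_proj x \<equiv> schur_null K V +>\<^bsub>free_decorated K V\<^esub> x"

lemma schur_proj_linear: "(\<lambda>x. schur_proj x) \<in> linear_maps K (free_decorated K V) (schur K V)"
  unfolding schur_def by (rule quotient_rcos_linear[OF free.module_axioms submodule_schur_null])

lemma schur_proj_relation:
  assumes "x \<ominus>\<^bsub>free_decorated K V\<^esub> y \<in> schur_relations K V"
    and "x \<in> carrier (free_decorated K V)" "y \<in> carrier (free_decorated K V)"
  shows "schur_proj x = schur_proj y"
proof -
  have "schur_proj (x \<ominus>\<^bsub>free_decorated K V\<^esub> y) = \<zero>\<^bsub>schur K V\<^esub>"
    unfolding schur_def
    by (rule quotient_rcos_eq_zero[OF free.module_axioms submodule_schur_null])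
      (rule subsetD[OF submodule_generated_superset assms(1)])
  then have "schur_proj x \<ominus>\<^bsub>schur K V\<^esub> schur_proj y = \<zero>\<^bsub>schur K V\<^esub>"
    by (rule trans[OF linear_maps_minus[OF free.module_axioms module_schur schur_proj_linear assms(2,3),
            symmetric]])
  moreover have "schur_proj x \<in> carrier (schur K V)" "schur_proj y \<in> carrier (schur K V)"
    using assms(2,3) by (auto intro: linear_maps_closed[OF schur_proj_linear])
  ultimately show ?thesis by (simp add: schur.minus_eq_zero_iff)
qed

lemma schur_class_eq_proj: "(w, z) \<in> decorated_words V \<Longrightarrow> schur_class K V w z = schur_proj (free_gen K (w, z))"
  by (subst schur_class_def) (auto simp: decorated_words_def PiE_restrict
      intro!: arg_cong[where f = "\<lambda>z. schur_proj (free_gen K (w, z))"])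

lemma schur_class_cong:
  "(\<And>s. s \<in> set w \<Longrightarrow> z s = z' s) \<Longrightarrow> schur_class K V w z = schur_class K V w z'"
  by (auto simp: schur_class_def restrict_def intro!: arg_cong[where f = "\<lambda>z. schur_proj (free_gen K (w, z))"])

lemma schur_class_restrict: "schur_class K V w (restrict z (set w)) = schur_class K V w z"
  by (rule schur_class_cong) simp

lemma schur_class_closed:
  assumes "w \<in> nc_words (set w)" "z \<in> set w \<rightarrow> carrier V"
  shows "schur_class K V w z \<in> carrier (schur K V)"
  unfolding schur_class_def
  by (rule linear_maps_closed[OF schur_proj_linear]) (rule free_gen_decorated[OF decorated_wordsI[OF assms]])

lemma schur_class_add:
  assumes "w \<in> nc_words (set w)" "z \<in> set w \<rightarrow> carrier V" "s \<in> set w" "a \<in> carrier V" "b \<in> carrier V"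
  shows "schur_class K V w (z(s := a \<oplus>\<^bsub>V\<^esub> b)) =
    schur_class K V w (z(s := a)) \<oplus>\<^bsub>schur K V\<^esub> schur_class K V w (z(s := b))"
proof -
  let ?z = "restrict z (set w)"
  have z: "(w, ?z) \<in> decorated_words V" by (rule decorated_wordsI[OF assms(1,2)])
  have upd: "restrict (z(s := x)) (set w) = ?z(s := x)" for x using assms(3) by auto
  have gen: "free_gen K (w, ?z(s := x)) \<in> carrier (free_decorated K V)" if "x \<in> carrier V" for x
    by (intro free_gen_decorated decorated_words_upd z assms that)
  show ?thesis
    unfolding schur_class_def upd using assms gen
    by (subst schur_proj_relation[OF schur_relations.additive[OF z assms(3-5)]])
      (simp_all add: linear_maps_add[OF schur_proj_linear])
qed

lemma schur_class_smult:
  assumes "w \<in> nc_words (set w)" "z \<in> set w \<rightarrow> carrier V" "s \<in> set w" "c \<in> carrier K" "a \<in> carrier V"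
  shows "schur_class K V w (z(s := c \<odot>\<^bsub>V\<^esub> a)) = c \<odot>\<^bsub>schur K V\<^esub> schur_class K V w (z(s := a))"
proof -
  let ?z = "restrict z (set w)"
  have z: "(w, ?z) \<in> decorated_words V" by (rule decorated_wordsI[OF assms(1,2)])
  have upd: "restrict (z(s := x)) (set w) = ?z(s := x)" for x using assms(3) by auto
  have gen: "free_gen K (w, ?z(s := x)) \<in> carrier (free_decorated K V)" if "x \<in> carrier V" for x
    by (intro free_gen_decorated decorated_words_upd z assms that)
  show ?thesis
    unfolding schur_class_def upd using assms gen
    by (subst schur_proj_relation[OF schur_relations.homogeneous[OF z assms(3-5)]])
      (simp_all add: linear_maps_smult[OF schur_proj_linear])
qed

text \<open>The relabelling relation for decorations that need not be extensional. Every later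
  argument about relabelling or renumbering goes through this form.\<close>

lemma schur_class_map:
  assumes "inj_on \<sigma> (set w)" "w \<in> nc_words (set w)" "z \<in> \<sigma> ` set w \<rightarrow> carrier V"
  shows "schur_class K V (map \<sigma> w) z = schur_class K V w (z \<circ> \<sigma>)"
proof -
  let ?z = "restrict z (set (map \<sigma> w))"
  have z: "(map \<sigma> w, ?z) \<in> decorated_words V"
    by (rule decorated_wordsI) (use assms nc_words_map in auto)
  have "schur_class K V (map \<sigma> w) z = schur_proj (free_gen K (map \<sigma> w, ?z))"
    by (simp add: schur_class_def)
  also have "\<dots> = schur_proj (free_gen K (w, restrict (?z \<circ> \<sigma>) (set w)))"
    by (intro schur_proj_relation schur_relations.relabel free_gen_decorated decorated_words_relabel
        assms z)
  also have "\<dots> = schur_class K V w (?z \<circ> \<sigma>)" by (simp add: schur_class_def)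
  also have "\<dots> = schur_class K V w (z \<circ> \<sigma>)" by (rule schur_class_cong) simp
  finally show ?thesis .
qed

text \<open>Pulled back along the projection, both maps are linear on a free module, where the
  generators decide.\<close>

lemma schur_linear_eqI:
  assumes W: "module K W" and h: "h \<in> linear_maps K (schur K V) W" "h' \<in> linear_maps K (schur K V) W"
    and eq: "\<And>w z. (w, z) \<in> decorated_words V \<Longrightarrow> h (schur_class K V w z) = h' (schur_class K V w z)"
    and x: "x \<in> carrier (schur K V)"
  shows "h x = h' x"
proof -
  from x obtain y where y: "y \<in> carrier (free_decorated K V)" "x = schur_proj y"
    unfolding schur_def quotient_carrier[OF free.module_axioms submodule_schur_null] by auto
  have "(h \<circ> (\<lambda>x. schur_proj x)) y = (h' \<circ> (\<lambda>x. schur_proj x)) y"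
    by (rule free_module_linear_maps_eqI[OF W linear_maps_comp[OF schur_proj_linear h(1)]
          linear_maps_comp[OF schur_proj_linear h(2)] _ y(1)])
      (use eq in \<open>auto simp: schur_class_eq_proj\<close>)
  then show ?thesis by (simp add: y)
qed

section \<open>Universal property of the Schur functor\<close>

context
  fixes W :: "('k, 'w, 'y) module_scheme" and F
  assumes W: "module K W" and F: "schur_compatible K V W F"
begin

interpretation W: module K W by (rule W)

text \<open>The free extension \<open>L\<close> of \<open>F\<close> kills each relation by the
  matching clause of \<open>schur_compatible\<close>. Its kernel is a submodule, so it contains
  everything the relations generate.\<close>

lemma schur_lift_exists:
  "\<exists>h \<in> linear_maps K (schur K V) W. \<forall>(w, z) \<in> decorated_words V. h (schur_class K V w z) = F w z"
proof -
  have "\<exists>L \<in> linear_maps K (free_decorated K V) W.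
      \<forall>wz\<in>decorated_words V. L (free_gen K wz) = (case wz of (w, z) \<Rightarrow> F w z)"
    by (rule free_module_lift_exists[OF W]) (use F in \<open>auto simp: schur_compatible_def\<close>)
  then obtain L where L: "L \<in> linear_maps K (free_decorated K V) W"
    and gen: "\<And>w z. (w, z) \<in> decorated_words V \<Longrightarrow> L (free_gen K (w, z)) = F w z" by auto
  note lin = linear_maps_minus[OF free.module_axioms W L] linear_maps_add[OF L] linear_maps_smult[OF L]
  have carF: "F w z \<in> carrier W" if "(w, z) \<in> decorated_words V" for w z
    using F that by (auto simp: schur_compatible_def)
  have "schur_relations K V \<subseteq> {x \<in> carrier (free_decorated K V). L x = \<zero>\<^bsub>W\<^esub>}"
  proof
    fix x assume x: "x \<in> schur_relations K V"
    from x have "L x = \<zero>\<^bsub>W\<^esub>"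
    proof cases
      case (additive w z s a b)
      then have "(w, z(s := a \<oplus>\<^bsub>V\<^esub> b)) \<in> decorated_words V" "(w, z(s := a)) \<in> decorated_words V"
        "(w, z(s := b)) \<in> decorated_words V"
        by (auto intro: decorated_words_upd)
      moreover have "F w (z(s := a \<oplus>\<^bsub>V\<^esub> b)) = F w (z(s := a)) \<oplus>\<^bsub>W\<^esub> F w (z(s := b))"
        using F additive by (auto simp: schur_compatible_def)
      ultimately show ?thesis
        unfolding additive(1) by (simp add: lin gen carF free_gen_decorated W.minus_eq_zero_iff)
    next
      case (homogeneous w z s c a)
      then have "(w, z(s := c \<odot>\<^bsub>V\<^esub> a)) \<in> decorated_words V" "(w, z(s := a)) \<in> decorated_words V"
        by (auto intro: decorated_words_upd)
      moreover have "F w (z(s := c \<odot>\<^bsub>V\<^esub> a)) = c \<odot>\<^bsub>W\<^esub> F w (z(s := a))"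
        using F homogeneous by (auto simp: schur_compatible_def)
      ultimately show ?thesis
        unfolding homogeneous(1) using homogeneous by (simp add: lin gen carF free_gen_decorated W.minus_eq_zero_iff)
    next
      case (relabel \<sigma> w z)
      have "(w, restrict (z \<circ> \<sigma>) (set w)) \<in> decorated_words V"
        by (rule decorated_words_relabel[OF relabel(2,3)])
      moreover have "F (map \<sigma> w) z = F w (restrict (z \<circ> \<sigma>) (set w))"
        using F relabel by (auto simp: schur_compatible_def)
      ultimately show ?thesis
        unfolding relabel(1) using relabel carF by (simp add: lin gen free_gen_decorated W.minus_eq_zero_iff)
    qed
    then show "x \<in> {x \<in> carrier (free_decorated K V). L x = \<zero>\<^bsub>W\<^esub>}"
      using x schur_relations_subset by blast
  qed
  then have "schur_null K V \<subseteq> {x \<in> carrier (free_decorated K V). L x = \<zero>\<^bsub>W\<^esub>}"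
    by (rule submodule_generated_least[OF submodule_kernel[OF free.module_axioms W L]])
  then obtain h where "h \<in> linear_maps K (schur K V) W"
    "\<forall>x\<in>carrier (free_decorated K V). h (schur_proj x) = L x"
    using quotient_lift_exists[OF free.module_axioms submodule_schur_null W L]
    unfolding schur_def by blast
  then show ?thesis
    using gen by (intro bexI[of _ h]) (auto simp: schur_class_eq_proj free_gen_decorated)
qed

text \<open>Makes the definite description in \<open>schur_lift\<close> meaningful. Linearity fixes
  the values on the carrier only, so a map is first restricted to the carrier for existence, and
  extensionality settles the remaining values for uniqueness.\<close>

lemma schur_lift_unique_existence:
  "\<exists>!h. h \<in> linear_maps K (schur K V) W \<and> h \<in> extensional (carrier (schur K V)) \<and>
     (\<forall>(w, z) \<in> decorated_words V. h (schur_class K V w z) = F w z)"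
proof (rule ex_ex1I)
  obtain h where h: "h \<in> linear_maps K (schur K V) W"
    "\<forall>(w, z) \<in> decorated_words V. h (schur_class K V w z) = F w z"
    using schur_lift_exists by blast
  have "restrict h (carrier (schur K V)) \<in> linear_maps K (schur K V) W"
    by (rule linear_mapsI)
      (simp_all add: linear_maps_closed[OF h(1)] linear_maps_add[OF h(1)] linear_maps_smult[OF h(1)])
  moreover have "schur_class K V w z \<in> carrier (schur K V)" if "(w, z) \<in> decorated_words V" for w z
    using that by (intro schur_class_closed) (auto simp: decorated_words_def)
  ultimately show "\<exists>h. h \<in> linear_maps K (schur K V) W \<and> h \<in> extensional (carrier (schur K V)) \<and>
     (\<forall>(w, z) \<in> decorated_words V. h (schur_class K V w z) = F w z)"
    using h(2) by (intro exI[of _ "restrict h (carrier (schur K V))"]) auto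
next
  fix h h'
  assume h: "h \<in> linear_maps K (schur K V) W \<and> h \<in> extensional (carrier (schur K V)) \<and>
     (\<forall>(w, z) \<in> decorated_words V. h (schur_class K V w z) = F w z)"
    and h': "h' \<in> linear_maps K (schur K V) W \<and> h' \<in> extensional (carrier (schur K V)) \<and>
     (\<forall>(w, z) \<in> decorated_words V. h' (schur_class K V w z) = F w z)"
  have "h x = h' x" if "x \<in> carrier (schur K V)" for x
    by (rule schur_linear_eqI[OF W _ _ _ that]) (use h h' in fastforce)+
  then show "h = h'"
    using h h' by (auto intro: extensionalityI)
qed

lemma schur_lift_linear: "schur_lift K V W F \<in> linear_maps K (schur K V) W"
  unfolding schur_lift_def using theI'[OF schur_lift_unique_existence] by blast

text \<open>The restriction cannot be dropped for a general \<open>F\<close>, which may depend on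
  values of \<open>z\<close> away from the letters of \<open>w\<close>.\<close>

lemma schur_lift_class:
  assumes "w \<in> nc_words (set w)" "z \<in> set w \<rightarrow> carrier V"
  shows "schur_lift K V W F (schur_class K V w z) = F w (restrict z (set w))"
proof -
  have "schur_lift K V W F (schur_class K V w (restrict z (set w))) = F w (restrict z (set w))"
    unfolding schur_lift_def
    using theI'[OF schur_lift_unique_existence] decorated_wordsI[OF assms] by blast
  then show ?thesis by (simp add: schur_class_restrict)
qed

end

end


section \<open>The structure maps on generators\<close>

lemma scalars_simps [simp]:
  "carrier (scalars K) = carrier K" "\<zero>\<^bsub>scalars K\<^esub> = \<zero>\<^bsub>K\<^esub>" "\<one>\<^bsub>scalars K\<^esub> = \<one>\<^bsub>K\<^esub>"
  "x \<oplus>\<^bsub>scalars K\<^esub> y = x \<oplus>\<^bsub>K\<^esub> y" "x \<otimes>\<^bsub>scalars K\<^esub> y = x \<otimes>\<^bsub>K\<^esub> y" "x \<odot>\<^bsub>scalars K\<^esub> y = x \<otimes>\<^bsub>K\<^esub> y"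
  by (simp_all add: scalars_def)

lemma cring_scalars:
  assumes "cring K"
  shows "cring (scalars K)"
proof -
  interpret cring K by fact
  show ?thesis
  proof (rule cringI)
    show "abelian_group (scalars K)"
    proof (rule abelian_groupI)
      fix x assume "x \<in> carrier (scalars K)"
      then show "\<exists>y\<in>carrier (scalars K). y \<oplus>\<^bsub>scalars K\<^esub> x = \<zero>\<^bsub>scalars K\<^esub>"
        by (auto intro!: bexI[of _ "\<ominus>\<^bsub>K\<^esub> x"] simp: l_neg)
    qed (auto simp: a_ac)
    show "comm_monoid (scalars K)"
      by (rule comm_monoidI) (auto simp: m_ac)
  qed (auto simp: l_distr)
qed

lemma module_scalars:
  assumes "cring K"
  shows "module K (scalars K)"
proof -
  interpret cring K by fact
  interpret S: cring "scalars K" by (rule cring_scalars[OF assms])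
  show ?thesis
    by (rule moduleI) (use assms S.is_abelian_group in \<open>auto simp: l_distr r_distr m_assoc\<close>)
qed

lemma list_product_closed:
  assumes "ring A" "set xs \<subseteq> carrier A"
  shows "list_product A xs \<in> carrier A"
proof -
  interpret ring A by fact
  show ?thesis using assms(2) by (induction xs) (auto simp: list_product_def)
qed

lemma list_product_add:
  assumes "ring A" "set xs \<subseteq> carrier A" "set ys \<subseteq> carrier A" "a \<in> carrier A" "b \<in> carrier A"
  shows "list_product A (xs @ (a \<oplus>\<^bsub>A\<^esub> b) # ys) =
    list_product A (xs @ a # ys) \<oplus>\<^bsub>A\<^esub> list_product A (xs @ b # ys)"
proof -
  interpret ring A by fact
  have [simp]: "foldr (\<otimes>\<^bsub>A\<^esub>) zs \<one>\<^bsub>A\<^esub> \<in> carrier A" if "set zs \<subseteq> carrier A" for zs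
    using list_product_closed[OF assms(1) that] by (simp add: list_product_def)
  have [simp]: "foldr (\<otimes>\<^bsub>A\<^esub>) zs (c \<otimes>\<^bsub>A\<^esub> foldr (\<otimes>\<^bsub>A\<^esub>) ys \<one>\<^bsub>A\<^esub>) \<in> carrier A"
    if "set zs \<subseteq> carrier A" "c \<in> carrier A" for zs c
    using list_product_closed[OF assms(1), of "zs @ c # ys"] that assms(3) by (simp add: list_product_def)
  show ?thesis
    using assms(2) by (induction xs) (use assms(3-5) in \<open>auto simp: list_product_def l_distr r_distr\<close>)
qed

text \<open>The structure shared by \<open>V\<close> and by the scalars as an algebra over
  themselves, so that both correlation maps are treated at once.\<close>

definition bilinear_algebra :: "('k, 'm) ring_scheme \<Rightarrow> ('k, 'a, 'x) module_scheme \<Rightarrow> bool" where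
  "bilinear_algebra K A \<longleftrightarrow> ring A \<and> module K A \<and>
     (\<forall>c\<in>carrier K. \<forall>x\<in>carrier A. \<forall>y\<in>carrier A.
        (c \<odot>\<^bsub>A\<^esub> x) \<otimes>\<^bsub>A\<^esub> y = c \<odot>\<^bsub>A\<^esub> (x \<otimes>\<^bsub>A\<^esub> y) \<and> x \<otimes>\<^bsub>A\<^esub> (c \<odot>\<^bsub>A\<^esub> y) = c \<odot>\<^bsub>A\<^esub> (x \<otimes>\<^bsub>A\<^esub> y))"

lemma list_product_smult:
  assumes "bilinear_algebra K A" "set xs \<subseteq> carrier A" "set ys \<subseteq> carrier A" "c \<in> carrier K" "a \<in> carrier A"
  shows "list_product A (xs @ (c \<odot>\<^bsub>A\<^esub> a) # ys) = c \<odot>\<^bsub>A\<^esub> list_product A (xs @ a # ys)"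
proof -
  have A: "ring A" "module K A" using assms(1) by (auto simp: bilinear_algebra_def)
  interpret ring A by fact
  have [simp]: "foldr (\<otimes>\<^bsub>A\<^esub>) ys \<one>\<^bsub>A\<^esub> \<in> carrier A"
    using list_product_closed[OF A(1) assms(3)] by (simp add: list_product_def)
  have [simp]: "foldr (\<otimes>\<^bsub>A\<^esub>) zs (a \<otimes>\<^bsub>A\<^esub> foldr (\<otimes>\<^bsub>A\<^esub>) ys \<one>\<^bsub>A\<^esub>) \<in> carrier A"
    if "set zs \<subseteq> carrier A" for zs
    using list_product_closed[OF A(1), of "zs @ a # ys"] that assms(3,5) by (simp add: list_product_def)
  show ?thesis
    using assms(2)
    by (induction xs) (use assms(1,4,5) in \<open>auto simp: list_product_def bilinear_algebra_def\<close>)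
qed

text \<open>In a list without repetitions a change of the decoration at \<open>s\<close> touches
  exactly one entry. This is the source of multilinearity for products over letters.\<close>

lemma map_fun_upd_split:
  assumes "distinct l" "s \<in> set l"
  obtains xs ys where "set xs \<union> set ys \<subseteq> set l" "\<And>x. map (z(s := x)) l = map z xs @ x # map z ys"
proof -
  from assms(2) obtain xs ys where l: "l = xs @ s # ys" by (auto simp: in_set_conv_decomp)
  with assms(1) show thesis by (intro that[of xs ys]) auto
qed

text \<open>The list of first occurrences contains each letter once, so the product is linear in
  each vector even if \<open>w\<close> repeats letters; and an injective relabelling keeps the order
  of first occurrence.\<close>

lemma algebra_correlation_compatible:
  assumes "bilinear_algebra K A"
  shows "schur_compatible K A A (\<lambda>w a. list_product A (map a (first_occurrences w)))"
proof (rule schur_compatibleI)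
  have A: "ring A" "module K A" using assms by (auto simp: bilinear_algebra_def)
  fix w z assume wz: "(w, z) \<in> decorated_words A"
  then have z: "z \<in> set w \<rightarrow> carrier A" by (auto simp: decorated_words_def)
  then show "list_product A (map z (first_occurrences w)) \<in> carrier A"
    by (intro list_product_closed[OF A(1)]) auto
  fix s a assume s: "s \<in> set w" and a: "a \<in> carrier A"
  obtain xs ys where sub: "set xs \<union> set ys \<subseteq> set w"
    and split: "\<And>x. map (z(s := x)) (first_occurrences w) = map z xs @ x # map z ys"
    using map_fun_upd_split[of "first_occurrences w" s z] s by auto
  have car: "set (map z xs) \<subseteq> carrier A" "set (map z ys) \<subseteq> carrier A" using sub z by auto
  show "list_product A (map (z(s := a \<oplus>\<^bsub>A\<^esub> b)) (first_occurrences w)) =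
      list_product A (map (z(s := a)) (first_occurrences w)) \<oplus>\<^bsub>A\<^esub>
      list_product A (map (z(s := b)) (first_occurrences w))" if "b \<in> carrier A" for b
    unfolding split by (rule list_product_add[OF A(1) car a that])
  show "list_product A (map (z(s := c \<odot>\<^bsub>A\<^esub> a)) (first_occurrences w)) =
      c \<odot>\<^bsub>A\<^esub> list_product A (map (z(s := a)) (first_occurrences w))" if "c \<in> carrier K" for c
    unfolding split by (rule list_product_smult[OF assms car that a])
next
  fix w z and \<sigma> :: "nat \<Rightarrow> nat"
  assume "inj_on \<sigma> (set w)"
  then show "list_product A (map z (first_occurrences (map \<sigma> w))) =
      list_product A (map (restrict (z \<circ> \<sigma>) (set w)) (first_occurrences w))"
    by (intro arg_cong[where f = "list_product A"]) (simp add: first_occurrences_map)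
qed

lemma algebra_correlation_linear:
  assumes "bilinear_algebra K A"
  shows "algebra_correlation K A \<in> linear_maps K (schur K A) A"
  unfolding algebra_correlation_def
  using assms by (intro schur_lift_linear algebra_correlation_compatible) (auto simp: bilinear_algebra_def)

lemma algebra_correlation_class:
  assumes "bilinear_algebra K A" "w \<in> nc_words (set w)" "z \<in> set w \<rightarrow> carrier A"
  shows "algebra_correlation K A (schur_class K A w z) = list_product A (map z (first_occurrences w))"
proof -
  have "map (restrict z (set w)) (first_occurrences w) = map z (first_occurrences w)"
    by (rule map_cong) simp_all
  moreover have A: "module K A" using assms(1) by (simp add: bilinear_algebra_def)
  ultimately show ?thesis
    unfolding algebra_correlation_def
    using schur_lift_class[OF A A algebra_correlation_compatible[OF assms(1)] assms(2,3)] by argo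
qed

section \<open>The counit and functoriality\<close>

lemma schur_counit_compatible:
  assumes "module K V"
  shows "schur_compatible K V V (\<lambda>w z. if card (set w) = 1 then z (hd w) else \<zero>\<^bsub>V\<^esub>)"
proof -
  interpret module K V by fact
  \<comment> \<open>With a single letter, an update at any letter of \<open>w\<close> is an update
    at its head; with more letters both sides of each identity vanish.\<close>
  have hd: "hd w = s" if "card (set w) = 1" "s \<in> set w" for w :: "nat list" and s
    using that by (metis card_1_singletonE empty_iff empty_set hd_in_set singletonD)
  show ?thesis
  proof (rule schur_compatibleI)
    fix w z assume "(w, z) \<in> decorated_words V"
    then show "(if card (set w) = 1 then z (hd w) else \<zero>\<^bsub>V\<^esub>) \<in> carrier V"
      by (auto simp: decorated_words_def nc_words_def PiE_mem)
  next
    fix w z and \<sigma> :: "nat \<Rightarrow> nat"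
    assume "inj_on \<sigma> (set w)" "(map \<sigma> w, z) \<in> decorated_words V"
    then show "(if card (set (map \<sigma> w)) = 1 then z (hd (map \<sigma> w)) else \<zero>\<^bsub>V\<^esub>) =
        (if card (set w) = 1 then restrict (z \<circ> \<sigma>) (set w) (hd w) else \<zero>\<^bsub>V\<^esub>)"
      by (auto simp: card_image decorated_words_def nc_words_def hd_map)
  qed (auto simp: hd)
qed

lemma schur_counit_linear: "module K V \<Longrightarrow> schur_counit K V \<in> linear_maps K (schur K V) V"
  unfolding schur_counit_def by (intro schur_lift_linear schur_counit_compatible)

lemma schur_counit_class:
  assumes "module K V" "w \<in> nc_words (set w)" "z \<in> set w \<rightarrow> carrier V"
  shows "schur_counit K V (schur_class K V w z) = (if card (set w) = 1 then z (hd w) else \<zero>\<^bsub>V\<^esub>)"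
  using schur_lift_class[OF assms(1,1) schur_counit_compatible[OF assms(1)] assms(2,3)] assms(2)
  by (auto simp: schur_counit_def nc_words_def)

lemma linear_maps_comp_funcset:
  "g \<in> linear_maps K V W \<Longrightarrow> z \<in> A \<rightarrow> carrier V \<Longrightarrow> g \<circ> z \<in> A \<rightarrow> carrier W"
  by (auto simp: linear_maps_def)

lemma schur_map_compatible:
  assumes V: "module K V" and W: "module K W" and g: "g \<in> linear_maps K V W"
  shows "schur_compatible K V (schur K W) (\<lambda>w z. schur_class K W w (g \<circ> z))"
proof (rule schur_compatibleI)
  fix w z assume "(w, z) \<in> decorated_words V"
  then have w: "w \<in> nc_words (set w)" and z: "g \<circ> z \<in> set w \<rightarrow> carrier W"
    using linear_maps_comp_funcset[OF g, of z "set w"] by (auto simp: decorated_words_def)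
  then show "schur_class K W w (g \<circ> z) \<in> carrier (schur K W)"
    by (rule schur_class_closed[OF W])
  fix s a assume s: "s \<in> set w" and a: "a \<in> carrier V"
  show "schur_class K W w (g \<circ> z(s := a \<oplus>\<^bsub>V\<^esub> b)) =
      schur_class K W w (g \<circ> z(s := a)) \<oplus>\<^bsub>schur K W\<^esub> schur_class K W w (g \<circ> z(s := b))"
    if "b \<in> carrier V" for b
    using schur_class_add[OF W w z s linear_maps_closed[OF g a] linear_maps_closed[OF g that]]
    by (simp add: fun_upd_comp linear_maps_add[OF g a that])
  show "schur_class K W w (g \<circ> z(s := c \<odot>\<^bsub>V\<^esub> a)) = c \<odot>\<^bsub>schur K W\<^esub> schur_class K W w (g \<circ> z(s := a))"
    if "c \<in> carrier K" for c
    using schur_class_smult[OF W w z s that linear_maps_closed[OF g a]]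
    by (simp add: fun_upd_comp linear_maps_smult[OF g that a])
next
  fix w z and \<sigma> :: "nat \<Rightarrow> nat"
  assume \<sigma>: "inj_on \<sigma> (set w)" and "(map \<sigma> w, z) \<in> decorated_words V"
  then have "w \<in> nc_words (set w)" "g \<circ> z \<in> \<sigma> ` set w \<rightarrow> carrier W"
    using linear_maps_comp_funcset[OF g, of z] nc_words_map_iff[OF \<sigma>]
    by (auto simp: decorated_words_def)
  then have "schur_class K W (map \<sigma> w) (g \<circ> z) = schur_class K W w (g \<circ> z \<circ> \<sigma>)"
    by (rule schur_class_map[OF W \<sigma>])
  also have "\<dots> = schur_class K W w (g \<circ> restrict (z \<circ> \<sigma>) (set w))"
    by (rule schur_class_cong[OF W]) simp
  finally show "schur_class K W (map \<sigma> w) (g \<circ> z) = schur_class K W w (g \<circ> restrict (z \<circ> \<sigma>) (set w))" .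
qed

lemma schur_map_linear:
  "module K V \<Longrightarrow> module K W \<Longrightarrow> g \<in> linear_maps K V W \<Longrightarrow>
    schur_map K V W g \<in> linear_maps K (schur K V) (schur K W)"
  unfolding schur_map_def by (intro schur_lift_linear schur_map_compatible module_schur)

lemma schur_map_class:
  assumes V: "module K V" and W: "module K W" and g: "g \<in> linear_maps K V W"
    and "w \<in> nc_words (set w)" "z \<in> set w \<rightarrow> carrier V"
  shows "schur_map K V W g (schur_class K V w z) = schur_class K W w (g \<circ> z)"
proof -
  have "schur_class K W w (g \<circ> restrict z (set w)) = schur_class K W w (g \<circ> z)"
    by (rule schur_class_cong[OF W]) simp
  then show ?thesis
    unfolding schur_map_def
    by (subst schur_lift_class[OF V module_schur[OF W] schur_map_compatible[OF V W g] assms(4,5)])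
qed

lemma schur_map_comp:
  assumes V: "module K V" and W: "module K W" and U: "module K U"
    and g: "g \<in> linear_maps K V W" and h: "h \<in> linear_maps K W U" and x: "x \<in> carrier (schur K V)"
  shows "schur_map K W U h (schur_map K V W g x) = schur_map K V U (h \<circ> g) x"
proof -
  note hg = linear_maps_comp[OF g h]
  have "(schur_map K W U h \<circ> schur_map K V W g) x = schur_map K V U (h \<circ> g) x"
  proof (rule schur_linear_eqI[OF V module_schur[OF U] _ _ _ x])
    show "schur_map K W U h \<circ> schur_map K V W g \<in> linear_maps K (schur K V) (schur K U)"
      by (rule linear_maps_comp) (rule schur_map_linear assms)+
    show "schur_map K V U (h \<circ> g) \<in> linear_maps K (schur K V) (schur K U)"
      by (rule schur_map_linear[OF V U hg])
    fix w z assume "(w, z) \<in> decorated_words V"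
    then have w: "w \<in> nc_words (set w)" and z: "z \<in> set w \<rightarrow> carrier V"
      by (auto simp: decorated_words_def)
    have "g \<circ> z \<in> set w \<rightarrow> carrier W" by (rule linear_maps_comp_funcset[OF g z])
    then show "(schur_map K W U h \<circ> schur_map K V W g) (schur_class K V w z) =
        schur_map K V U (h \<circ> g) (schur_class K V w z)"
      using schur_map_class[OF V W g w z] schur_map_class[OF W U h w] schur_map_class[OF V U hg w z]
      by (simp add: comp_assoc)
  qed
  then show ?thesis by simp
qed


section \<open>Comultiplication\<close>

text \<open>The summand of the comultiplication at \<open>f\<close>. It makes sense for every
  \<open>f\<close>, not only for representatives, so that a surjection can be compared with its
  renumbering.\<close>

definition comult_term ::
    "('k, 'm) ring_scheme \<Rightarrow> ('k, 'v, 'x) module_scheme \<Rightarrow> nat list \<Rightarrow> (nat \<Rightarrow> 'v) \<Rightarrow> (nat \<Rightarrow> nat)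
      \<Rightarrow> (('v decorated \<Rightarrow> 'k) set decorated \<Rightarrow> 'k) set" where
  "comult_term K V w z f = schur_class K (schur K V) (reduction (map f w))
     (\<lambda>t. schur_class K V (reduction (filter (\<lambda>s. f s = t) w)) z)"

lemma nc_words_nonempty: "w \<in> nc_words S \<Longrightarrow> w \<noteq> []"
  by (simp add: nc_words_def)

lemma nc_words_not_crossing: "w \<in> nc_words S \<Longrightarrow> \<not> crossing w"
  by (simp add: nc_words_def)

text \<open>Requiring \<open>t\<close> to be attained keeps the fibre word from being empty.\<close>

lemma fibre_word_in_nc_words:
  assumes "w \<in> nc_words (set w)" "t \<in> f ` set w"
  shows "reduction (filter (\<lambda>s. f s = t) w) \<in> nc_words (set (reduction (filter (\<lambda>s. f s = t) w)))"
proof -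
  from assms(2) obtain s where "s \<in> set w" "f s = t" by auto
  then show ?thesis
    using reduction_filter_in_nc_words[of w s "\<lambda>s. f s = t"] nc_words_not_crossing[OF assms(1)]
    by simp
qed

lemma image_word_in_nc_words:
  assumes "w \<in> nc_words (set w)" "\<not> crossing (map f w)"
  shows "reduction (map f w) \<in> nc_words (set (reduction (map f w)))"
  using reduction_in_nc_words[of "map f w"] nc_words_nonempty[OF assms(1)] assms(2) by simp

abbreviation nc_surj_reps :: "nat list \<Rightarrow> (nat \<Rightarrow> nat) set" where
  "nc_surj_reps w \<equiv> {f \<in> surj_reps (set w). \<not> crossing (map f w)}"

lemma crossing_canonical_rep:
  "crossing (map (canonical_rep (set w) f) w) \<longleftrightarrow> crossing (map f w)"
proof -
  obtain \<tau> where \<tau>: "inj_on \<tau> (f ` set w)" "\<And>s. s \<in> set w \<Longrightarrow> canonical_rep (set w) f s = \<tau> (f s)"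
    using canonical_rep_factor[of "set w" f] by auto
  then have "map (canonical_rep (set w) f) w = map \<tau> (map f w)" by simp
  moreover have "crossing (map \<tau> (map f w)) \<longleftrightarrow> crossing (map f w)"
    by (rule crossing_map_iff) (simp add: \<tau>(1))
  ultimately show ?thesis by (simp only:)
qed

text \<open>Renumbering the values of a surjection does not change whether the image word crosses,
  so the bijection of representatives restricts to those indexing the comultiplication.\<close>

lemma bij_betw_nc_surj_reps:
  assumes "inj_on \<sigma> (set w)"
  shows "bij_betw (\<lambda>f. canonical_rep (set w) (f \<circ> \<sigma>)) (nc_surj_reps (map \<sigma> w)) (nc_surj_reps w)"
proof -
  let ?h = "\<lambda>f. canonical_rep (set w) (f \<circ> \<sigma>)"
  have bij: "bij_betw ?h (surj_reps (set (map \<sigma> w))) (surj_reps (set w))"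
    using bij_betw_surj_reps[of "set w" \<sigma>] assms by simp
  have "crossing (map (?h f) w) \<longleftrightarrow> crossing (map f (map \<sigma> w))" for f
    using crossing_canonical_rep[of w "f \<circ> \<sigma>"] by simp
  then have "?h ` nc_surj_reps (map \<sigma> w) = {f \<in> ?h ` surj_reps (set (map \<sigma> w)). \<not> crossing (map f w)}"
    by blast
  then show ?thesis
    using bij by (simp add: bij_betw_def inj_on_def)
qed

context
  fixes K :: "('k, 'm) ring_scheme" and V :: "('k, 'v, 'x) module_scheme"
  assumes V: "module K V"
begin

interpretation V: module K V by (rule V)
interpretation schur: module K "schur K V" by (rule module_schur[OF V])
interpretation schur2: module K "schur K (schur K V)" by (rule module_schur[OF module_schur[OF V]])

lemma fibre_class_closed:
  assumes "w \<in> nc_words (set w)" "z \<in> set w \<rightarrow> carrier V"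
  shows "(\<lambda>t. schur_class K V (reduction (filter (\<lambda>s. f s = t) w)) z)
    \<in> set (reduction (map f w)) \<rightarrow> carrier (schur K V)"
  using assms by (intro funcsetI schur_class_closed[OF V] fibre_word_in_nc_words) auto

lemma comult_term_closed:
  assumes "w \<in> nc_words (set w)" "z \<in> set w \<rightarrow> carrier V" "\<not> crossing (map f w)"
  shows "comult_term K V w z f \<in> carrier (schur K (schur K V))"
  unfolding comult_term_def
  using assms by (intro schur_class_closed[OF schur.module_axioms] image_word_in_nc_words fibre_class_closed)

text \<open>The letter \<open>s\<close> lies in one fibre only, so changing its vector changes one
  decoration of the outer word, the one at \<open>f s\<close>. Linearity in \<open>s\<close> then
  follows from linearity of the inner class and of the outer class in turn.\<close>

lemma comult_term_upd:
  assumes "s \<in> set w"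
  shows "comult_term K V w (z(s := x)) f = schur_class K (schur K V) (reduction (map f w))
    ((\<lambda>t. schur_class K V (reduction (filter (\<lambda>s. f s = t) w)) z)
      (f s := schur_class K V (reduction (filter (\<lambda>s'. f s' = f s) w)) (z(s := x))))"
  unfolding comult_term_def
proof (rule schur_class_cong[OF schur.module_axioms])
  fix t assume "t \<in> set (reduction (map f w))"
  show "schur_class K V (reduction (filter (\<lambda>s. f s = t) w)) (z(s := x)) =
    ((\<lambda>t. schur_class K V (reduction (filter (\<lambda>s. f s = t) w)) z)
      (f s := schur_class K V (reduction (filter (\<lambda>s'. f s' = f s) w)) (z(s := x)))) t"
    by (auto intro!: schur_class_cong[OF V])
qed

context
  fixes w :: "nat list" and z :: "nat \<Rightarrow> 'v" and f :: "nat \<Rightarrow> nat" and s :: nat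
  assumes w: "w \<in> nc_words (set w)" and z: "z \<in> set w \<rightarrow> carrier V"
    and f: "\<not> crossing (map f w)" and s: "s \<in> set w"
begin

lemma fibre_class_upd_closed:
  assumes "a \<in> carrier V"
  shows "schur_class K V (reduction (filter (\<lambda>s'. f s' = f s) w)) (z(s := a)) \<in> carrier (schur K V)"
  using w z s assms by (intro schur_class_closed[OF V] fibre_word_in_nc_words) auto

lemma comult_term_add:
  assumes "a \<in> carrier V" "b \<in> carrier V"
  shows "comult_term K V w (z(s := a \<oplus>\<^bsub>V\<^esub> b)) f =
    comult_term K V w (z(s := a)) f \<oplus>\<^bsub>schur K (schur K V)\<^esub> comult_term K V w (z(s := b)) f"
proof -
  let ?u = "reduction (filter (\<lambda>s'. f s' = f s) w)"
  have "schur_class K V ?u (z(s := a \<oplus>\<^bsub>V\<^esub> b)) =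
      schur_class K V ?u (z(s := a)) \<oplus>\<^bsub>schur K V\<^esub> schur_class K V ?u (z(s := b))"
    using w z s assms by (intro schur_class_add[OF V] fibre_word_in_nc_words) auto
  then show ?thesis
    unfolding comult_term_upd[OF s]
    using schur_class_add[OF schur.module_axioms image_word_in_nc_words[OF w f]
        fibre_class_closed[OF w z] _ fibre_class_upd_closed[OF assms(1)] fibre_class_upd_closed[OF assms(2)]] s
    by simp
qed

lemma comult_term_smult:
  assumes "c \<in> carrier K" "a \<in> carrier V"
  shows "comult_term K V w (z(s := c \<odot>\<^bsub>V\<^esub> a)) f =
    c \<odot>\<^bsub>schur K (schur K V)\<^esub> comult_term K V w (z(s := a)) f"
proof -
  let ?u = "reduction (filter (\<lambda>s'. f s' = f s) w)"
  have "schur_class K V ?u (z(s := c \<odot>\<^bsub>V\<^esub> a)) = c \<odot>\<^bsub>schur K V\<^esub> schur_class K V ?u (z(s := a))"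
    using w z s assms by (intro schur_class_smult[OF V] fibre_word_in_nc_words) auto
  then show ?thesis
    unfolding comult_term_upd[OF s]
    using schur_class_smult[OF schur.module_axioms image_word_in_nc_words[OF w f]
        fibre_class_closed[OF w z] _ assms(1) fibre_class_upd_closed[OF assms(2)]] s
    by simp
qed

end

section \<open>Renumbering and relabelling in the comultiplication\<close>

lemma comult_term_cong:
  assumes "\<And>s. s \<in> set w \<Longrightarrow> z s = z' s" "\<And>s. s \<in> set w \<Longrightarrow> f s = f' s"
  shows "comult_term K V w z f = comult_term K V w z' f'"
proof -
  have "map f w = map f' w" using assms(2) by simp
  moreover have "filter (\<lambda>s. f s = t) w = filter (\<lambda>s. f' s = t) w" for t
    by (rule filter_cong) (simp_all add: assms(2))
  moreover have "schur_class K V (reduction (filter P w)) z = schur_class K V (reduction (filter P w)) z'" for P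
    by (rule schur_class_cong[OF V]) (use assms(1) in auto)
  ultimately show ?thesis by (simp only: comult_term_def)
qed

text \<open>An injective renaming of the values of \<open>f\<close> leaves the fibres as they are
  and relabels the outer word together with the indices of its decorations, so the outer relabelling
  relation absorbs it.\<close>

lemma comult_term_comp:
  assumes "w \<in> nc_words (set w)" "z \<in> set w \<rightarrow> carrier V" "\<not> crossing (map f w)" "inj_on \<tau> (f ` set w)"
  shows "comult_term K V w z (\<tau> \<circ> f) = comult_term K V w z f"
proof -
  have "reduction (map (\<tau> \<circ> f) w) = map \<tau> (reduction (map f w))"
    using reduction_map[of \<tau> "map f w"] assms(4) by simp
  moreover have "schur_class K (schur K V) (map \<tau> (reduction (map f w)))
      (\<lambda>t. schur_class K V (reduction (filter (\<lambda>s. (\<tau> \<circ> f) s = t) w)) z) =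
    schur_class K (schur K V) (reduction (map f w))
      ((\<lambda>t. schur_class K V (reduction (filter (\<lambda>s. (\<tau> \<circ> f) s = t) w)) z) \<circ> \<tau>)"
  proof (rule schur_class_map[OF schur.module_axioms])
    show "(\<lambda>t. schur_class K V (reduction (filter (\<lambda>s. (\<tau> \<circ> f) s = t) w)) z)
        \<in> \<tau> ` set (reduction (map f w)) \<rightarrow> carrier (schur K V)"
      using fibre_class_closed[OF assms(1,2), of "\<tau> \<circ> f"] by (auto simp: image_comp)
  qed (use assms image_word_in_nc_words in auto)
  moreover have "\<dots> = comult_term K V w z f"
    unfolding comult_term_def
  proof (rule schur_class_cong[OF schur.module_axioms])
    fix t assume "t \<in> set (reduction (map f w))"
    then have "filter (\<lambda>s. (\<tau> \<circ> f) s = \<tau> t) w = filter (\<lambda>s. f s = t) w"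
      using assms(4) by (intro filter_cong) (auto simp: inj_on_def)
    then show "((\<lambda>t. schur_class K V (reduction (filter (\<lambda>s. (\<tau> \<circ> f) s = t) w)) z) \<circ> \<tau>) t =
        schur_class K V (reduction (filter (\<lambda>s. f s = t) w)) z"
      by simp
  qed
  ultimately show ?thesis by (simp add: comult_term_def)
qed

text \<open>Relabelling the letters of \<open>w\<close> carries the fibres of
  \<open>f \<circ> \<sigma>\<close> to those of \<open>f\<close>, so here the relabelling relation
  is applied to the inner classes.\<close>

lemma comult_term_map:
  assumes "inj_on \<sigma> (set w)" "w \<in> nc_words (set w)" "z \<in> \<sigma> ` set w \<rightarrow> carrier V"
  shows "comult_term K V (map \<sigma> w) z f = comult_term K V w (z \<circ> \<sigma>) (f \<circ> \<sigma>)"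
proof -
  have "schur_class K V (reduction (filter (\<lambda>s. f s = t) (map \<sigma> w))) z =
      schur_class K V (reduction (filter (\<lambda>s. (f \<circ> \<sigma>) s = t) w)) (z \<circ> \<sigma>)"
    if "t \<in> (f \<circ> \<sigma>) ` set w" for t
  proof -
    let ?u = "filter (\<lambda>s. (f \<circ> \<sigma>) s = t) w"
    have sub: "set ?u \<subseteq> set w" by auto
    have "reduction (filter (\<lambda>s. f s = t) (map \<sigma> w)) = map \<sigma> (reduction ?u)"
      using reduction_map[of \<sigma> ?u] inj_on_subset[OF assms(1) sub] by (simp add: filter_map comp_def)
    moreover have "schur_class K V (map \<sigma> (reduction ?u)) z = schur_class K V (reduction ?u) (z \<circ> \<sigma>)"
      using inj_on_subset[OF assms(1) sub] fibre_word_in_nc_words[OF assms(2) that] assms(3)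
      by (intro schur_class_map[OF V]) auto
    ultimately show ?thesis by simp
  qed
  then have "schur_class K (schur K V) (reduction (map (f \<circ> \<sigma>) w))
      (\<lambda>t. schur_class K V (reduction (filter (\<lambda>s. f s = t) (map \<sigma> w))) z) =
    comult_term K V w (z \<circ> \<sigma>) (f \<circ> \<sigma>)"
    unfolding comult_term_def by (intro schur_class_cong[OF schur.module_axioms]) simp
  then show ?thesis by (simp add: comult_term_def)
qed

lemma comult_term_canonical_rep:
  assumes "w \<in> nc_words (set w)" "z \<in> set w \<rightarrow> carrier V" "\<not> crossing (map f w)"
  shows "comult_term K V w z (canonical_rep (set w) f) = comult_term K V w z f"
proof -
  obtain \<tau> where \<tau>: "inj_on \<tau> (f ` set w)" "\<And>s. s \<in> set w \<Longrightarrow> canonical_rep (set w) f s = \<tau> (f s)"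
    using canonical_rep_factor[of "set w" f] by auto
  have "comult_term K V w z (canonical_rep (set w) f) = comult_term K V w z (\<tau> \<circ> f)"
    by (rule comult_term_cong) (simp_all add: \<tau>(2))
  also have "\<dots> = comult_term K V w z f" by (rule comult_term_comp[OF assms \<tau>(1)])
  finally show ?thesis .
qed

text \<open>Linearity holds summand by summand. Relabelling does not: it permutes the summands along
  the bijection of representatives, so the sums agree only after reindexing.\<close>

lemma comult_compatible:
  "schur_compatible K V (schur K (schur K V)) (\<lambda>w z. \<Oplus>\<^bsub>schur K (schur K V)\<^esub> f \<in> nc_surj_reps w. comult_term K V w z f)"
proof (rule schur_compatibleI)
  fix w and z :: "nat \<Rightarrow> 'v" assume "(w, z) \<in> decorated_words V"
  then have w: "w \<in> nc_words (set w)" and z: "z \<in> set w \<rightarrow> carrier V" by (auto simp: decorated_words_def)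
  show "(\<Oplus>\<^bsub>schur K (schur K V)\<^esub> f \<in> nc_surj_reps w. comult_term K V w z f) \<in> carrier (schur K (schur K V))"
    by (rule schur2.finsum_closed) (auto intro: comult_term_closed[OF w z])
  fix s a assume s: "s \<in> set w" and a: "a \<in> carrier V"
  have upd: "z(s := x) \<in> set w \<rightarrow> carrier V" if "x \<in> carrier V" for x using z that by auto
  have car: "(\<lambda>f. comult_term K V w (z(s := x)) f) \<in> nc_surj_reps w \<rightarrow> carrier (schur K (schur K V))"
    if "x \<in> carrier V" for x
    by (auto intro: comult_term_closed[OF w upd[OF that]])
  show "(\<Oplus>\<^bsub>schur K (schur K V)\<^esub> f \<in> nc_surj_reps w. comult_term K V w (z(s := a \<oplus>\<^bsub>V\<^esub> b)) f) =
      (\<Oplus>\<^bsub>schur K (schur K V)\<^esub> f \<in> nc_surj_reps w. comult_term K V w (z(s := a)) f) \<oplus>\<^bsub>schur K (schur K V)\<^esub>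
      (\<Oplus>\<^bsub>schur K (schur K V)\<^esub> f \<in> nc_surj_reps w. comult_term K V w (z(s := b)) f)"
    if b: "b \<in> carrier V" for b
    unfolding schur2.finsum_addf[OF car[OF a] car[OF b], symmetric]
    by (rule schur2.finsum_cong')
      (use car[OF a] car[OF b] in \<open>auto intro!: comult_term_add[OF w z _ s a b]\<close>)
  show "(\<Oplus>\<^bsub>schur K (schur K V)\<^esub> f \<in> nc_surj_reps w. comult_term K V w (z(s := c \<odot>\<^bsub>V\<^esub> a)) f) =
      c \<odot>\<^bsub>schur K (schur K V)\<^esub> (\<Oplus>\<^bsub>schur K (schur K V)\<^esub> f \<in> nc_surj_reps w. comult_term K V w (z(s := a)) f)"
    if c: "c \<in> carrier K" for c
  proof -
    have fin: "finite (nc_surj_reps w)" by (simp add: finite_surj_reps)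
    show ?thesis
      unfolding schur2.finsum_smult_ldistr[OF fin c car[OF a]]
      by (rule schur2.finsum_cong')
        (use car[OF a] c in \<open>auto intro!: comult_term_smult[OF w z _ s c a]\<close>)
  qed
next
  fix w and z :: "nat \<Rightarrow> 'v" and \<sigma> :: "nat \<Rightarrow> nat"
  assume \<sigma>: "inj_on \<sigma> (set w)" and wz: "(map \<sigma> w, z) \<in> decorated_words V"
  then have w: "w \<in> nc_words (set w)" and z: "z \<in> \<sigma> ` set w \<rightarrow> carrier V"
    using nc_words_map_iff[OF \<sigma>] by (auto simp: decorated_words_def)
  let ?z = "restrict (z \<circ> \<sigma>) (set w)"
  have z': "?z \<in> set w \<rightarrow> carrier V" using z by auto
  let ?h = "\<lambda>f. canonical_rep (set w) (f \<circ> \<sigma>)"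
  have bij: "?h ` nc_surj_reps (map \<sigma> w) = nc_surj_reps w" "inj_on ?h (nc_surj_reps (map \<sigma> w))"
    using bij_betw_nc_surj_reps[OF \<sigma>] by (simp_all only: bij_betw_def)
  have car: "(\<lambda>f. comult_term K V w ?z f) \<in> nc_surj_reps w \<rightarrow> carrier (schur K (schur K V))"
    by (auto intro: comult_term_closed[OF w z'])
  \<comment> \<open>The inner words absorb \<open>\<sigma>\<close>, after which the outer word
    absorbs the renumbering of \<open>f \<circ> \<sigma>\<close>.\<close>
  have eq: "comult_term K V (map \<sigma> w) z f = comult_term K V w ?z (?h f)"
    if "f \<in> nc_surj_reps (map \<sigma> w)" for f
  proof -
    have "comult_term K V (map \<sigma> w) z f = comult_term K V w (z \<circ> \<sigma>) (f \<circ> \<sigma>)"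
      by (rule comult_term_map[OF \<sigma> w z])
    also have "\<dots> = comult_term K V w ?z (f \<circ> \<sigma>)" by (rule comult_term_cong) simp_all
    also have "\<dots> = comult_term K V w ?z (?h f)"
      using that by (intro comult_term_canonical_rep[OF w z', symmetric]) simp
    finally show ?thesis .
  qed
  have "(\<Oplus>\<^bsub>schur K (schur K V)\<^esub> f \<in> nc_surj_reps w. comult_term K V w ?z f) =
      (\<Oplus>\<^bsub>schur K (schur K V)\<^esub> f \<in> nc_surj_reps (map \<sigma> w). comult_term K V w ?z (?h f))"
    using schur2.finsum_reindex[of "comult_term K V w ?z" ?h "nc_surj_reps (map \<sigma> w)"] bij car by simp
  also have "\<dots> = (\<Oplus>\<^bsub>schur K (schur K V)\<^esub> f \<in> nc_surj_reps (map \<sigma> w). comult_term K V (map \<sigma> w) z f)"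
  proof (rule schur2.finsum_cong'[OF refl])
    show "(\<lambda>f. comult_term K V (map \<sigma> w) z f) \<in> nc_surj_reps (map \<sigma> w) \<rightarrow> carrier (schur K (schur K V))"
      using comult_term_closed[of "map \<sigma> w" z] wz by (auto simp: decorated_words_def)
  qed (rule eq[symmetric])
  finally show "(\<Oplus>\<^bsub>schur K (schur K V)\<^esub> f \<in> nc_surj_reps (map \<sigma> w). comult_term K V (map \<sigma> w) z f) =
      (\<Oplus>\<^bsub>schur K (schur K V)\<^esub> f \<in> nc_surj_reps w. comult_term K V w ?z f)" ..
qed

lemma schur_comult_eq_lift:
  "schur_comult K V = schur_lift K V (schur K (schur K V))
     (\<lambda>w z. \<Oplus>\<^bsub>schur K (schur K V)\<^esub> f \<in> nc_surj_reps w. comult_term K V w z f)"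
  by (simp add: schur_comult_def comult_term_def)

lemma schur_comult_linear: "schur_comult K V \<in> linear_maps K (schur K V) (schur K (schur K V))"
  unfolding schur_comult_eq_lift by (rule schur_lift_linear[OF V schur2.module_axioms comult_compatible])

lemma schur_comult_class:
  assumes w: "w \<in> nc_words (set w)" and z: "z \<in> set w \<rightarrow> carrier V"
  shows "schur_comult K V (schur_class K V w z) =
    (\<Oplus>\<^bsub>schur K (schur K V)\<^esub> f \<in> nc_surj_reps w. comult_term K V w z f)"
proof -
  have "comult_term K V w (restrict z (set w)) = comult_term K V w z"
    by (rule ext, rule comult_term_cong) simp_all
  then show ?thesis
    unfolding schur_comult_eq_lift schur_lift_class[OF V schur2.module_axioms comult_compatible assms]
    by simp
qed

end


section \<open>Counit laws\<close>

lemma crossing_card: "crossing w \<Longrightarrow> card (set w) \<noteq> 1"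
proof -
  assume "crossing w"
  then obtain a b where "a \<noteq> b" "subseq [a, b, a, b] w" by (auto simp: crossing_def)
  then have "a \<noteq> b" "{a, b} \<subseteq> set w"
    using subseq_imp_set_subset by fastforce+
  then show ?thesis by (auto simp: card_1_singleton_iff)
qed

lemma constant_surj_rep: "S \<noteq> {} \<Longrightarrow> (\<lambda>s\<in>S. 1) \<in> surj_reps S"
  by (auto simp: surj_reps_def intro!: exI[of _ 1])

lemma surj_rep_card_image_1:
  assumes "f \<in> surj_reps S" "card (f ` S) = 1"
  shows "f = (\<lambda>s\<in>S. 1)"
proof
  fix s
  obtain k where k: "f ` S = {1..k}" "f \<in> extensional S" using assms(1) by (auto simp: surj_reps_def)
  then have "f ` S = {1}" using assms(2) by simp
  then show "f s = (\<lambda>s\<in>S. 1) s" using k(2) by (auto simp: extensional_def)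
qed

lemma schur_class_zero:
  assumes V: "module K V" and w: "w \<in> nc_words (set w)" and z: "z \<in> set w \<rightarrow> carrier V"
    and s: "s \<in> set w" "z s = \<zero>\<^bsub>V\<^esub>"
  shows "schur_class K V w z = \<zero>\<^bsub>schur K V\<^esub>"
proof -
  interpret module K V by fact
  interpret schur: module K "schur K V" by (rule module_schur[OF V])
  \<comment> \<open>Writing \<open>z\<close> as its own update at \<open>s\<close> lets homogeneity
    with the scalar zero apply.\<close>
  have "z(s := \<zero>\<^bsub>V\<^esub>) = z" using s(2) by auto
  then show ?thesis
    using schur_class_smult[OF V w z s(1) R.zero_closed M.zero_closed] schur_class_closed[OF V w z]
    by simp
qed

context
  fixes K :: "('k, 'm) ring_scheme" and V :: "('k, 'v, 'x) module_scheme"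
    and W :: "('k, 'w, 'y) module_scheme" and g :: "('v decorated \<Rightarrow> 'k) set \<Rightarrow> 'w"
  assumes V: "module K V" and W: "module K W" and g: "g \<in> linear_maps K (schur K V) W"
begin

interpretation W: module K W by (rule W)
interpretation schur: module K "schur K V" by (rule module_schur[OF V])
interpretation schurW: module K "schur K W" by (rule module_schur[OF W])
interpretation schur2: module K "schur K (schur K V)" by (rule module_schur[OF module_schur[OF V]])

lemma cofree_lift_linear: "cofree_lift K V W g \<in> linear_maps K (schur K V) (schur K W)"
  unfolding cofree_lift_def
  by (rule linear_maps_comp[OF schur_comult_linear[OF V] schur_map_linear[OF schur.module_axioms W g]])

lemma cofree_lift_class:
  assumes w: "w \<in> nc_words (set w)" and z: "z \<in> set w \<rightarrow> carrier V"
  shows "cofree_lift K V W g (schur_class K V w z) =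
    (\<Oplus>\<^bsub>schur K W\<^esub> f \<in> nc_surj_reps w. schur_class K W (reduction (map f w))
      (\<lambda>t. g (schur_class K V (reduction (filter (\<lambda>s. f s = t) w)) z)))"
proof -
  have fin: "finite (nc_surj_reps w)" by (simp add: finite_surj_reps)
  have "cofree_lift K V W g (schur_class K V w z) =
      schur_map K (schur K V) W g (\<Oplus>\<^bsub>schur K (schur K V)\<^esub> f \<in> nc_surj_reps w. comult_term K V w z f)"
    by (simp add: cofree_lift_def schur_comult_class[OF V w z])
  also have "\<dots> = (\<Oplus>\<^bsub>schur K W\<^esub> f \<in> nc_surj_reps w. schur_map K (schur K V) W g (comult_term K V w z f))"
    by (rule linear_maps_finsum[OF schur2.module_axioms schurW.module_axioms
          schur_map_linear[OF schur.module_axioms W g] fin])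
      (auto intro: comult_term_closed[OF V w z])
  also have "\<dots> = (\<Oplus>\<^bsub>schur K W\<^esub> f \<in> nc_surj_reps w. schur_class K W (reduction (map f w))
      (\<lambda>t. g (schur_class K V (reduction (filter (\<lambda>s. f s = t) w)) z)))"
  proof (rule schurW.finsum_cong'[OF refl])
    show eq: "schur_map K (schur K V) W g (comult_term K V w z f) = schur_class K W (reduction (map f w))
        (\<lambda>t. g (schur_class K V (reduction (filter (\<lambda>s. f s = t) w)) z))" if "f \<in> nc_surj_reps w" for f
      using schur_map_class[OF schur.module_axioms W g image_word_in_nc_words[OF w]
          fibre_class_closed[OF V w z]] that
      by (simp add: comult_term_def comp_def)
    show "(\<lambda>f. schur_class K W (reduction (map f w))
        (\<lambda>t. g (schur_class K V (reduction (filter (\<lambda>s. f s = t) w)) z))) \<in> nc_surj_reps w \<rightarrow> carrier (schur K W)"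
      using linear_maps_closed[OF schur_map_linear[OF schur.module_axioms W g] comult_term_closed[OF V w z]]
      by (auto simp flip: eq)
  qed
  finally show ?thesis .
qed

lemma cofree_term_props:
  assumes w: "w \<in> nc_words (set w)" and z: "z \<in> set w \<rightarrow> carrier V" and f: "\<not> crossing (map f w)"
  shows "(\<lambda>t. g (schur_class K V (reduction (filter (\<lambda>s. f s = t) w)) z)) \<in> set (reduction (map f w)) \<rightarrow> carrier W"
    and "schur_class K W (reduction (map f w))
        (\<lambda>t. g (schur_class K V (reduction (filter (\<lambda>s. f s = t) w)) z)) \<in> carrier (schur K W)"
proof -
  show *: "(\<lambda>t. g (schur_class K V (reduction (filter (\<lambda>s. f s = t) w)) z)) \<in> set (reduction (map f w)) \<rightarrow> carrier W"
    using linear_maps_comp_funcset[OF g fibre_class_closed[OF V w z]] by (simp only: comp_def)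
  show "schur_class K W (reduction (map f w))
        (\<lambda>t. g (schur_class K V (reduction (filter (\<lambda>s. f s = t) w)) z)) \<in> carrier (schur K W)"
    by (rule schur_class_closed[OF W image_word_in_nc_words[OF w f] *])
qed

text \<open>The outer counit annihilates every image word with more than one letter. What survives
  is the constant surjection, whose only fibre is the whole word.\<close>

lemma schur_counit_cofree_lift:
  assumes "x \<in> carrier (schur K V)"
  shows "schur_counit K W (cofree_lift K V W g x) = g x"
proof -
  have "(schur_counit K W \<circ> cofree_lift K V W g) x = g x"
  proof (rule schur_linear_eqI[OF V W _ g _ assms])
    show "schur_counit K W \<circ> cofree_lift K V W g \<in> linear_maps K (schur K V) W"
      by (rule linear_maps_comp[OF cofree_lift_linear schur_counit_linear[OF W]])
    fix w z assume "(w, z) \<in> decorated_words V"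
    then have w: "w \<in> nc_words (set w)" and z: "z \<in> set w \<rightarrow> carrier V"
      by (auto simp: decorated_words_def)
    then have "w \<noteq> []" by (simp add: nc_words_def)
    define c where "c = (\<lambda>s\<in>set w. 1 :: nat)"
    let ?Z = "\<lambda>f t. g (schur_class K V (reduction (filter (\<lambda>s. f s = t) w)) z)"
    let ?T = "\<lambda>f. schur_class K W (reduction (map f w)) (?Z f)"
    have fin: "finite (nc_surj_reps w)" by (simp add: finite_surj_reps)
    have set_c: "c ` set w = {1}" using \<open>w \<noteq> []\<close> by (simp add: c_def image_constant_conv)
    have "c \<in> surj_reps (set w)" unfolding c_def by (rule constant_surj_rep) (simp add: \<open>w \<noteq> []\<close>)
    \<comment> \<open>The image word uses a single letter, and a crossing needs two.\<close>
    then have c: "c \<in> nc_surj_reps w" using crossing_card[of "map c w"] set_c by auto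
    have val: "schur_counit K W (?T f) = (if card (f ` set w) = 1 then ?Z f (hd (reduction (map f w))) else \<zero>\<^bsub>W\<^esub>)"
      if "f \<in> nc_surj_reps w" for f
      using schur_counit_class[OF W image_word_in_nc_words[OF w] cofree_term_props(1)[OF w z]] that by simp
    have "(schur_counit K W \<circ> cofree_lift K V W g) (schur_class K V w z) =
        (\<Oplus>\<^bsub>W\<^esub> f \<in> nc_surj_reps w. schur_counit K W (?T f))"
      unfolding comp_def cofree_lift_class[OF w z]
      by (rule linear_maps_finsum[OF schurW.module_axioms W schur_counit_linear[OF W] fin])
        (auto intro: cofree_term_props(2)[OF w z])
    also have "\<dots> = (\<Oplus>\<^bsub>W\<^esub> f \<in> {c}. schur_counit K W (?T f))"
    proof (rule W.add.finprod_mono_neutral_cong_right[OF fin])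
      show "schur_counit K W (?T f) = \<zero>\<^bsub>W\<^esub>" if "f \<in> nc_surj_reps w - {c}" for f
        using that val[of f] surj_rep_card_image_1[of f "set w"] by (auto simp: c_def)
      show "(\<lambda>f. schur_counit K W (?T f)) \<in> nc_surj_reps w \<rightarrow> carrier W"
        by (auto intro!: linear_maps_closed[OF schur_counit_linear[OF W]] cofree_term_props(2)[OF w z])
    qed (use c in auto)
    also have "\<dots> = schur_counit K W (?T c)"
      using c by (simp add: linear_maps_closed[OF schur_counit_linear[OF W]] cofree_term_props(2)[OF w z])
    also have "\<dots> = ?Z c (hd (reduction (map c w)))" using val[OF c] set_c by simp
    also have "hd (reduction (map c w)) = 1"
      using hd_in_set[of "reduction (map c w)"] set_c \<open>w \<noteq> []\<close> by auto
    also have "filter (\<lambda>s. c s = 1) w = w" by (simp add: c_def)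
    also have "reduction w = w" using w by (intro reduction_reduced) (simp add: nc_words_def)
    finally show "(schur_counit K W \<circ> cofree_lift K V W g) (schur_class K V w z) = g (schur_class K V w z)" .
  qed
  then show ?thesis by simp
qed

end

text \<open>Here the inner counits act: a surjection that is not injective has a fibre with several
  letters, and the zero decoration there annihilates the outer class. All injective surjections form
  one isomorphism class, leaving a single summand.\<close>

lemma cofree_lift_schur_counit:
  fixes V :: "('k, 'v, 'x) module_scheme"
  assumes V: "module K V" and x: "x \<in> carrier (schur K V)"
  shows "cofree_lift K V V (schur_counit K V) x = x"
proof -
  interpret schur: module K "schur K V" by (rule module_schur[OF V])
  note g = schur_counit_linear[OF V]
  show ?thesis
  proof (rule schur_linear_eqI[OF V schur.module_axioms cofree_lift_linear[OF V V g] _ _ x])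
    show "(\<lambda>x. x) \<in> linear_maps K (schur K V) (schur K V)" by (auto intro: linear_mapsI)
    fix w z assume "(w, z) \<in> decorated_words V"
    then have w: "w \<in> nc_words (set w)" and z: "z \<in> set w \<rightarrow> carrier V"
      by (auto simp: decorated_words_def)
    let ?u = "\<lambda>f t. reduction (filter (\<lambda>s. f s = t) w)"
    let ?Z = "\<lambda>f t. schur_counit K V (schur_class K V (?u f t) z)"
    let ?T = "\<lambda>f. schur_class K V (reduction (map f w)) (?Z f)"
    \<comment> \<open>The representative of the class of injective surjections: it sends each letter
      to its rank.\<close>
    define c where "c = canonical_rep (set w) id"
    have fin: "finite (nc_surj_reps w)" by (simp add: finite_surj_reps)
    have c: "c \<in> nc_surj_reps w"
      using w canonical_rep_in_surj_reps[of "set w" id] crossing_canonical_rep[of w id]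
      by (simp add: c_def nc_words_def)
    have inj_c: "inj_on c (set w)"
      using canonical_rep_eq_iff[of "set w" _ _ id] by (auto simp: inj_on_def c_def)
    have val: "?Z f (f s) = (if card {s' \<in> set w. f s' = f s} = 1 then z (hd (?u f (f s))) else \<zero>\<^bsub>V\<^esub>)"
      if "s \<in> set w" for f and s
    proof -
      have "z \<in> set (?u f (f s)) \<rightarrow> carrier V" using z by auto
      then show ?thesis
        using schur_counit_class[OF V fibre_word_in_nc_words[OF w], of "f s" f z] that by simp
    qed
    have "?T f = \<zero>\<^bsub>schur K V\<^esub>" if f: "f \<in> nc_surj_reps w - {c}" for f
    proof -
      have "\<not> inj_on f (set w)"
      proof
        assume "inj_on f (set w)"
        then have "canonical_rep (set w) f = c"
          unfolding c_def by (intro canonical_rep_cong) (auto simp: inj_on_def)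
        then show False using f canonical_rep_surj_rep[of "set w" f] by simp
      qed
      then obtain s s' where s: "s \<in> set w" "s' \<in> set w" "f s = f s'" "s \<noteq> s'"
        by (auto simp: inj_on_def)
      have "card {s' \<in> set w. f s' = f s} \<noteq> 1"
      proof
        assume "card {s' \<in> set w. f s' = f s} = 1"
        then obtain r where "{s' \<in> set w. f s' = f s} = {r}" by (rule card_1_singletonE)
        then have "s \<in> {r}" "s' \<in> {r}" using s by auto
        then show False using s(4) by simp
      qed
      then have "?Z f (f s) = \<zero>\<^bsub>V\<^esub>" using val[OF s(1), of f] by simp
      moreover have "f s \<in> set (reduction (map f w))" using s by simp
      ultimately show ?thesis
        using f by (intro schur_class_zero[OF V image_word_in_nc_words[OF w] cofree_term_props(1)[OF V V g w z]]) auto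
    qed
    then have "cofree_lift K V V (schur_counit K V) (schur_class K V w z) = (\<Oplus>\<^bsub>schur K V\<^esub> f \<in> {c}. ?T f)"
      unfolding cofree_lift_class[OF V V g w z]
      by (intro schur.add.finprod_mono_neutral_cong_right[OF fin])
        (use c in \<open>auto intro: cofree_term_props(2)[OF V V g w z]\<close>)
    also have "\<dots> = ?T c"
      using c by (simp add: cofree_term_props(2)[OF V V g w z])
    also have "reduction (map c w) = map c w"
      using reduction_map[OF inj_c] w by (simp add: nc_words_def reduction_reduced)
    \<comment> \<open>The outer word is \<open>w\<close> with its letters replaced by their ranks;
      undoing this relabelling returns each vector to its own letter.\<close>
    also have "schur_class K V (map c w) (?Z c) = schur_class K V w (?Z c \<circ> c)"
      using cofree_term_props(1)[OF V V g w z, of c] c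
      by (intro schur_class_map[OF V inj_c w]) auto
    also have "\<dots> = schur_class K V w z"
    proof (rule schur_class_cong[OF V])
      fix s assume s: "s \<in> set w"
      have fib: "{s' \<in> set w. c s' = c s} = {s}" using inj_c s by (auto simp: inj_on_def)
      have "set (?u c (c s)) = {s}" using fib by simp
      then have "hd (?u c (c s)) = s" by (metis empty_iff hd_in_set list.set(1) singletonD insertI1)
      then show "(?Z c \<circ> c) s = z s" using val[OF s, of c] fib by simp
    qed
    finally show "cofree_lift K V V (schur_counit K V) (schur_class K V w z) = schur_class K V w z" .
  qed
qed

text \<open>Uniqueness half of cofreeness: write \<open>F x\<close> by the second counit law, move
  the comultiplication past \<open>F\<close>, and fuse the two Schur maps into that of the
  adjoint.\<close>

lemma coalgebra_map_eq_cofree_lift: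
  assumes V: "module K V" and W: "module K W" and F: "coalgebra_map K V W F" and x: "x \<in> carrier (schur K V)"
  shows "F x = cofree_lift K V W (schur_counit K W \<circ> F) x"
proof -
  have lin: "F \<in> linear_maps K (schur K V) (schur K W)"
    and comult: "schur_comult K W (F x) = schur_map K (schur K V) (schur K W) F (schur_comult K V x)"
    using F x by (auto simp: coalgebra_map_def)
  have "F x = cofree_lift K W W (schur_counit K W) (F x)"
    by (rule cofree_lift_schur_counit[OF W linear_maps_closed[OF lin x], symmetric])
  also have "\<dots> = schur_map K (schur K W) W (schur_counit K W)
      (schur_map K (schur K V) (schur K W) F (schur_comult K V x))"
    by (simp add: cofree_lift_def comult)
  also have "\<dots> = schur_map K (schur K V) W (schur_counit K W \<circ> F) (schur_comult K V x)"
    by (rule schur_map_comp[OF module_schur[OF V] module_schur[OF W] W lin schur_counit_linear[OF W]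
          linear_maps_closed[OF schur_comult_linear[OF V] x]])
  finally show ?thesis by (simp add: cofree_lift_def)
qed


section \<open>Moments and cumulants\<close>

lemma finsum_scalars:
  assumes "cring K" "finite A" "f \<in> A \<rightarrow> carrier K"
  shows "finsum (scalars K) f A = finsum K f A"
proof -
  interpret cring K by fact
  interpret S: cring "scalars K" by (rule cring_scalars[OF assms(1)])
  show ?thesis
    using assms(2,3)
  proof (induction A rule: finite_induct)
    case empty
    then show ?case by simp
  next
    case (insert x A)
    then have "f x \<in> carrier K" "f \<in> A \<rightarrow> carrier K" by auto
    then show ?case using insert by simp
  qed
qed

text \<open>Commutativity of \<open>K\<close> removes the dependence on the order of the letters, so
  a product along first occurrences becomes a product over the set of blocks.\<close>

lemma list_product_scalars:
  assumes "cring K" "distinct xs" "f \<in> set xs \<rightarrow> carrier K"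
  shows "list_product (scalars K) (map f xs) = finprod K f (set xs)"
proof -
  interpret cring K by fact
  show ?thesis
    using assms(2,3)
  proof (induction xs)
    case Nil
    then show ?case by (simp add: list_product_def)
  next
    case (Cons x xs)
    then have "f x \<in> carrier K" "f \<in> set xs \<rightarrow> carrier K" by auto
    then show ?case using Cons by (simp add: list_product_def)
  qed
qed

lemma bilinear_algebra_scalars: "cring K \<Longrightarrow> bilinear_algebra K (scalars K)"
proof -
  assume K: "cring K"
  interpret cring K by fact
  show ?thesis
    using cring_scalars[OF K] module_scalars[OF K] m_lcomm
    by (auto simp: bilinear_algebra_def cring_def m_assoc)
qed

text \<open>Letters are numbered from 1 and list positions from 0, hence the shift by one.\<close>

lemma map_nth_shift: "map (\<lambda>i. xs ! (i - 1)) [1..<Suc (length xs)] = xs"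
  by (rule nth_equalityI) (simp_all del: upt_Suc)

text \<open>A block of a partition is an increasing word with gaps in its letters. Replacing each
  letter by its position gives the standard word of the same length, so the class depends only on
  the list of vectors along the block, as a cumulant does.\<close>

lemma schur_class_standard:
  assumes V: "module K V" and u: "distinct u" "u \<noteq> []" and z: "z \<in> set u \<rightarrow> carrier V"
  shows "schur_class K V u z = schur_class K V [1..<Suc (length u)] (\<lambda>i. map z u ! (i - 1))"
proof -
  let ?w = "[1..<Suc (length u)]" and ?\<sigma> = "\<lambda>i. u ! (i - 1)"
  have "inj_on ?\<sigma> (set ?w)"
    using u(1) by (auto simp: inj_on_def nth_eq_iff_index_eq)
  moreover have "?w \<in> nc_words (set ?w)"
    by (rule distinct_in_nc_words) (use u(2) in \<open>simp_all add: Suc_le_eq\<close>)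
  moreover have "z \<in> ?\<sigma> ` set ?w \<rightarrow> carrier V"
    using z by (auto simp: Pi_def)
  ultimately have "schur_class K V (map ?\<sigma> ?w) z = schur_class K V ?w (z \<circ> ?\<sigma>)"
    by (rule schur_class_map[OF V])
  also have "\<dots> = schur_class K V ?w (\<lambda>i. map z u ! (i - 1))"
    by (rule schur_class_cong[OF V]) auto
  finally show ?thesis by (simp only: map_nth_shift)
qed

lemma length_fibre_word: "length (filter (\<lambda>j. f j = i) [1..<Suc N]) = card {j \<in> {1..N}. f j = i}"
proof -
  have "card (set (filter (\<lambda>j. f j = i) [1..<Suc N])) = length (filter (\<lambda>j. f j = i) [1..<Suc N])"
    by (rule distinct_card) simp
  moreover have "set (filter (\<lambda>j. f j = i) [1..<Suc N]) = {j \<in> {1..N}. f j = i}" by auto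
  ultimately show ?thesis by simp
qed

text \<open>The moment side of the moment-cumulant relation, for any linear \<open>k\<close>: each
  summand of the lift contributes one factor \<open>k\<close> per block, and the block words are
  standard up to relabelling, so the factors are values of the functionals read off from
  \<open>k\<close> on standard words.\<close>

lemma algebra_correlation_cofree_lift:
  assumes K: "cring K" and V: "module K V" and k: "k \<in> linear_maps K (schur K V) (scalars K)"
    and N: "N \<ge> 1" and a: "a \<in> {1..N} \<rightarrow> carrier V"
  shows "algebra_correlation K (scalars K) (cofree_lift K V (scalars K) k (schur_class K V [1..<Suc N] a)) =
    (\<Oplus>\<^bsub>K\<^esub> f \<in> nc_partitions N.
      mult_extension K (\<lambda>n xs. k (schur_class K V [1..<Suc n] (\<lambda>i. xs ! (i - 1)))) N f a)"
proof -
  interpret K: cring K by fact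
  note S = module_scalars[OF K] and B = bilinear_algebra_scalars[OF K]
  interpret S: module K "scalars K" by (rule S)
  let ?w = "[1..<Suc N]"
  let ?\<kappa> = "\<lambda>n xs. k (schur_class K V [1..<Suc n] (\<lambda>i. xs ! (i - 1)))"
  let ?Z = "\<lambda>f t. k (schur_class K V (reduction (filter (\<lambda>s. f s = t) ?w)) a)"
  let ?T = "\<lambda>f. schur_class K (scalars K) (reduction (map f ?w)) (?Z f)"
  have set_w: "set ?w = {1..N}" by auto
  have w: "?w \<in> nc_words (set ?w)" by (rule distinct_in_nc_words) (use N in auto)
  have z: "a \<in> set ?w \<rightarrow> carrier V" using a unfolding set_w .
  \<comment> \<open>On the word 1, ..., N the image word lists the values of \<open>f\<close> in
    order, so the surjections allowed by the cooperad are literally the non-crossing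
    partitions.\<close>
  have reps: "nc_surj_reps ?w = nc_partitions N" by (simp only: nc_partitions_def set_w)
  have fin: "finite (nc_partitions N)" by (simp add: nc_partitions_def finite_surj_reps)
  have f_nc: "\<not> crossing (map f ?w)" if "f \<in> nc_partitions N" for f
    using that by (simp add: nc_partitions_def)
  have T_closed: "?T f \<in> carrier (schur K (scalars K))" if "f \<in> nc_partitions N" for f
    by (rule cofree_term_props(2)[OF V S k w z f_nc[OF that]])
  have corr: "algebra_correlation K (scalars K) (?T f) = mult_extension K ?\<kappa> N f a"
    if f: "f \<in> nc_partitions N" for f
  proof -
    note Z_scalars = cofree_term_props(1)[OF V S k w z f_nc[OF f]]
    then have Zcar: "?Z f \<in> set (reduction (map f ?w)) \<rightarrow> carrier K" by (simp only: scalars_simps)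
    have "algebra_correlation K (scalars K) (?T f) =
        list_product (scalars K) (map (?Z f) (first_occurrences (reduction (map f ?w))))"
      by (rule algebra_correlation_class[OF B image_word_in_nc_words[OF w f_nc[OF f]] Z_scalars])
    also have "\<dots> = finprod K (?Z f) (set (first_occurrences (reduction (map f ?w))))"
      by (rule list_product_scalars[OF K distinct_first_occurrences]) (simp only: set_first_occurrences Zcar)
    \<comment> \<open>The image word may repeat labels and be shortened by reduction, but no label
      is lost, so every block contributes exactly one factor.\<close>
    also have "set (first_occurrences (reduction (map f ?w))) = f ` {1..N}"
      by (simp only: set_first_occurrences set_reduction set_map set_w)
    also have "finprod K (?Z f) (f ` {1..N}) = mult_extension K ?\<kappa> N f a"
      unfolding mult_extension_def
    proof (rule K.finprod_cong'[OF refl])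
      have Z: "?Z f i = ?\<kappa> (card {j \<in> {1..N}. f j = i}) (map a (filter (\<lambda>j. f j = i) ?w))"
        if "i \<in> f ` {1..N}" for i
      proof -
        let ?u = "filter (\<lambda>j. f j = i) ?w"
        have ne: "?u \<noteq> []" using that by (auto simp: filter_empty_conv)
        \<comment> \<open>A subword of 1, ..., N repeats no letter, so there is nothing to
          reduce.\<close>
        have "reduction ?u = ?u"
          using distinct_in_nc_words[of ?u] ne by (intro reduction_reduced) (simp add: nc_words_def)
        moreover have "schur_class K V ?u a =
            schur_class K V [1..<Suc (length ?u)] (\<lambda>i. map a ?u ! (i - 1))"
          by (rule schur_class_standard[OF V _ ne]) (use z in auto)
        ultimately show ?thesis by (simp only: length_fibre_word)
      qed
      then show "?Z f i = ?\<kappa> (card {j \<in> {1..N}. f j = i}) (map a (filter (\<lambda>j. f j = i) ?w))"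
        if "i \<in> f ` {1..N}" for i using that .
      show "(\<lambda>i. ?\<kappa> (card {j \<in> {1..N}. f j = i}) (map a (filter (\<lambda>j. f j = i) ?w))) \<in> f ` {1..N} \<rightarrow> carrier K"
      proof
        fix i assume i: "i \<in> f ` {1..N}"
        then have "i \<in> set (reduction (map f ?w))" by (simp only: set_reduction set_map set_w)
        then have "?Z f i \<in> carrier K" by (rule funcset_mem[OF Zcar])
        then show "?\<kappa> (card {j \<in> {1..N}. f j = i}) (map a (filter (\<lambda>j. f j = i) ?w)) \<in> carrier K"
          by (simp only: Z[OF i])
      qed
    qed
    finally show ?thesis .
  qed
  have T_fun: "?T \<in> nc_partitions N \<rightarrow> carrier (schur K (scalars K))" using T_closed by blast
  have corr_closed: "algebra_correlation K (scalars K) (?T f) \<in> carrier K" if "f \<in> nc_partitions N" for f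
    using linear_maps_closed[OF algebra_correlation_linear[OF B] T_closed[OF that]] by simp
  have "algebra_correlation K (scalars K) (cofree_lift K V (scalars K) k (schur_class K V ?w a)) =
      (\<Oplus>\<^bsub>scalars K\<^esub> f \<in> nc_partitions N. algebra_correlation K (scalars K) (?T f))"
    unfolding cofree_lift_class[OF V S k w z] reps
    by (rule linear_maps_finsum[OF module_schur[OF S] S algebra_correlation_linear[OF B] fin T_fun])
  also have "\<dots> = (\<Oplus>\<^bsub>K\<^esub> f \<in> nc_partitions N. algebra_correlation K (scalars K) (?T f))"
    by (rule finsum_scalars[OF K fin]) (use corr_closed in blast)
  also have "\<dots> = (\<Oplus>\<^bsub>K\<^esub> f \<in> nc_partitions N. mult_extension K ?\<kappa> N f a)"
    by (rule K.finsum_cong'[OF refl]) (use corr corr_closed in auto)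
  finally show ?thesis .
qed

text \<open>The constant partition contributes \<open>\<kappa> N xs\<close>; all other terms only involve lower orders.\<close>

lemma moment_cumulant_unique:
  assumes K: "cring K"
    and closed: "\<And>n xs. n \<ge> 1 \<Longrightarrow> length xs = n \<Longrightarrow> set xs \<subseteq> A \<Longrightarrow> \<kappa> n xs \<in> carrier K"
      "\<And>n xs. n \<ge> 1 \<Longrightarrow> length xs = n \<Longrightarrow> set xs \<subseteq> A \<Longrightarrow> \<kappa>' n xs \<in> carrier K"
    and eq: "\<And>N a. N \<ge> 1 \<Longrightarrow> a \<in> {1..N} \<rightarrow> A \<Longrightarrow>
      (\<Oplus>\<^bsub>K\<^esub> f \<in> nc_partitions N. mult_extension K \<kappa> N f a) =
      (\<Oplus>\<^bsub>K\<^esub> f \<in> nc_partitions N. mult_extension K \<kappa>' N f a)"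
  shows "N \<ge> 1 \<Longrightarrow> length xs = N \<Longrightarrow> set xs \<subseteq> A \<Longrightarrow> \<kappa> N xs = \<kappa>' N xs"
proof (induction N arbitrary: xs rule: less_induct)
  case (less N)
  interpret K: cring K by fact
  define a where "a = (\<lambda>i. xs ! (i - 1))"
  have xs: "map a [1..<Suc N] = xs" using less.prems map_nth_shift[of xs] by (simp add: a_def)
  have a: "a \<in> {1..N} \<rightarrow> A"
  proof
    fix i assume "i \<in> {1..N}"
    then have "xs ! (i - 1) \<in> set xs" using less.prems(2) by (intro nth_mem) auto
    then show "a i \<in> A" using less.prems(3) by (auto simp: a_def)
  qed
  define c where "c = (\<lambda>s\<in>{1..N}. 1 :: nat)"
  let ?w = "[1..<Suc N]"
  let ?u = "\<lambda>f i. filter (\<lambda>j. f j = i) ?w"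
  have set_w: "set ?w = {1..N}" by auto
  have u: "length (?u f i) = card {j \<in> {1..N}. f j = i}" "length (?u f i) \<ge> 1" "set (map a (?u f i)) \<subseteq> A"
    if "i \<in> f ` {1..N}" for f and i :: nat
  proof -
    show "length (?u f i) = card {j \<in> {1..N}. f j = i}" by (rule length_fibre_word)
    have "?u f i \<noteq> []" using that by (auto simp: filter_empty_conv)
    then show "length (?u f i) \<ge> 1" by (simp add: Suc_le_eq)
    show "set (map a (?u f i)) \<subseteq> A" using a by auto
  qed
  have ext_closed: "mult_extension K \<rho> N f a \<in> carrier K"
    if "\<And>n xs. n \<ge> 1 \<Longrightarrow> length xs = n \<Longrightarrow> set xs \<subseteq> A \<Longrightarrow> \<rho> n xs \<in> carrier K" for \<rho> f
    unfolding mult_extension_def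
  proof (rule K.finprod_closed, rule funcsetI)
    fix i assume "i \<in> f ` {1..N}"
    from u[OF this] show "\<rho> (card {j \<in> {1..N}. f j = i}) (map a (?u f i)) \<in> carrier K"
      by (intro that) auto
  qed
  have set_c: "c ` {1..N} = {1}" using less.prems(1) by (simp add: c_def image_constant_conv)
  have "c \<in> surj_reps {1..N}" unfolding c_def by (rule constant_surj_rep) (use less.prems(1) in simp)
  moreover have "\<not> crossing (map c ?w)"
  proof
    assume "crossing (map c ?w)"
    from crossing_card[OF this] show False unfolding set_map set_w set_c by simp
  qed
  ultimately have c: "c \<in> nc_partitions N" by (simp add: nc_partitions_def)
  have ext_c: "mult_extension K \<rho> N c a = \<rho> N xs" if "\<rho> N xs \<in> carrier K" for \<rho>
  proof -
    have "{j \<in> {1..N}. c j = 1} = {1..N}" by (auto simp: c_def)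
    then have "card {j \<in> {1..N}. c j = 1} = N" by (simp only: card_atLeastAtMost diff_Suc_1)
    moreover have "?u c 1 = ?w" by (auto simp: c_def filter_id_conv)
    ultimately have "\<rho> (card {j \<in> {1..N}. c j = 1}) (map a (?u c 1)) = \<rho> N xs"
      by (simp only: xs)
    then show ?thesis
      unfolding mult_extension_def set_c using that by (subst K.finprod_insert) simp_all
  qed
  have ext_eq: "mult_extension K \<kappa> N f a = mult_extension K \<kappa>' N f a" if f: "f \<in> nc_partitions N - {c}" for f
    unfolding mult_extension_def
  proof (rule K.finprod_cong'[OF refl])
    fix i assume i: "i \<in> f ` {1..N}"
    \<comment> \<open>A block filling {1..N} would make \<open>f\<close> constant, hence equal to
      \<open>c\<close>. So every block is strictly smaller than N, and the induction hypothesis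
      applies to the sublist of vectors along it.\<close>
    have "{j \<in> {1..N}. f j = i} \<noteq> {1..N}"
    proof
      assume "{j \<in> {1..N}. f j = i} = {1..N}"
      then have "f ` {1..N} = {i}" using i by blast
      then have "f = c"
        using f surj_rep_card_image_1[of f "{1..N}"] by (simp add: nc_partitions_def c_def)
      then show False using f by simp
    qed
    then have "card {j \<in> {1..N}. f j = i} < card {1..N}" by (intro psubset_card_mono) auto
    then show "\<kappa> (card {j \<in> {1..N}. f j = i}) (map a (?u f i)) =
        \<kappa>' (card {j \<in> {1..N}. f j = i}) (map a (?u f i))"
      using u[OF i] by (intro less.IH) auto
  next
    show "(\<lambda>i. \<kappa>' (card {j \<in> {1..N}. f j = i}) (map a (?u f i))) \<in> f ` {1..N} \<rightarrow> carrier K"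
    proof
      fix i assume "i \<in> f ` {1..N}"
      from u[OF this] show "\<kappa>' (card {j \<in> {1..N}. f j = i}) (map a (?u f i)) \<in> carrier K"
        by (intro closed(2)) auto
    qed
  qed
  let ?R = "\<lambda>\<rho>. \<Oplus>\<^bsub>K\<^esub> f \<in> nc_partitions N - {c}. mult_extension K \<rho> N f a"
  have fin: "finite (nc_partitions N)" by (simp add: nc_partitions_def finite_surj_reps)
  \<comment> \<open>Kept general in \<open>\<rho>\<close> to serve both families; the remainders
    agree by \<open>ext_eq\<close>, and cancelling them isolates the values at N.\<close>
  have split: "(\<Oplus>\<^bsub>K\<^esub> f \<in> nc_partitions N. mult_extension K \<rho> N f a) = \<rho> N xs \<oplus>\<^bsub>K\<^esub> ?R \<rho>"
    if "\<And>n xs. n \<ge> 1 \<Longrightarrow> length xs = n \<Longrightarrow> set xs \<subseteq> A \<Longrightarrow> \<rho> n xs \<in> carrier K" for \<rho>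
  proof -
    have \<rho>: "\<rho> N xs \<in> carrier K" using less.prems by (intro that) auto
    have "(\<Oplus>\<^bsub>K\<^esub> f \<in> insert c (nc_partitions N - {c}). mult_extension K \<rho> N f a) =
        mult_extension K \<rho> N c a \<oplus>\<^bsub>K\<^esub> ?R \<rho>"
      by (rule K.finsum_insert) (use fin ext_closed[of \<rho>, OF that] in auto)
    moreover have "insert c (nc_partitions N - {c}) = nc_partitions N" using c by blast
    ultimately show ?thesis by (simp only: ext_c[of \<rho>, OF \<rho>])
  qed
  have R: "?R \<kappa> = ?R \<kappa>'"
    by (rule K.finsum_cong'[OF refl]) (use ext_eq ext_closed[of \<kappa>', OF closed(2)] in auto)
  have "\<kappa> N xs \<oplus>\<^bsub>K\<^esub> ?R \<kappa>' = \<kappa>' N xs \<oplus>\<^bsub>K\<^esub> ?R \<kappa>'"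
  proof -
    have "(\<Oplus>\<^bsub>K\<^esub> f \<in> nc_partitions N. mult_extension K \<kappa> N f a) = \<kappa> N xs \<oplus>\<^bsub>K\<^esub> ?R \<kappa>"
      by (rule split) (rule closed(1))
    moreover have "(\<Oplus>\<^bsub>K\<^esub> f \<in> nc_partitions N. mult_extension K \<kappa>' N f a) = \<kappa>' N xs \<oplus>\<^bsub>K\<^esub> ?R \<kappa>'"
      by (rule split) (rule closed(2))
    ultimately show ?thesis using eq[OF less.prems(1) a] by (simp only: R)
  qed
  moreover have "?R \<kappa>' \<in> carrier K"
    by (rule K.finsum_closed) (use ext_closed[of \<kappa>', OF closed(2)] in auto)
  moreover have "\<kappa> N xs \<in> carrier K" "\<kappa>' N xs \<in> carrier K"
    using less.prems by (auto intro: closed)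
  ultimately show ?case by (simp add: K.add.right_cancel)
qed

theorem theorem3p2:
  fixes K :: "'k ring" and V :: "('k, 'v) module" and E :: "'v \<Rightarrow> 'k"
    and \<K> :: "('v decorated \<Rightarrow> 'k) set \<Rightarrow> ('k decorated \<Rightarrow> 'k) set"
    and \<kappa> :: "nat \<Rightarrow> 'v list \<Rightarrow> 'k"
    and N :: nat and v :: "nat \<Rightarrow> 'v"
  assumes "field K"
    and char_0: "\<And>n::nat. n > 0 \<Longrightarrow> [n] \<cdot>\<^bsub>K\<^esub> \<one>\<^bsub>K\<^esub> \<noteq> \<zero>\<^bsub>K\<^esub>"
    and "nc_probability_space K V E"
    and "cumulant_morphism K V (algebra_correlation K V) (algebra_correlation K (scalars K)) E \<K>"
    and "free_cumulants K V E \<kappa>"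
    and "N \<ge> 1"
    and "v \<in> {1..N} \<rightarrow> carrier V"
  shows "schur_counit K (scalars K) (\<K> (schur_class K V [1..<Suc N] v)) = \<kappa> N (map v [1..<Suc N])"
proof -
  interpret K: field K by fact
  have K: "cring K" by unfold_locales
  have V: "module K V" and E: "E \<in> linear_maps K V (scalars K)" and B: "bilinear_algebra K V"
    using assms(3) by (simp_all add: nc_probability_space_def bilinear_algebra_def)
  note S = module_scalars[OF K] and BS = bilinear_algebra_scalars[OF K]
  let ?\<phi>V = "algebra_correlation K V" and ?\<phi>K = "algebra_correlation K (scalars K)"
  note \<phi>V = algebra_correlation_linear[OF B] and \<phi>K = algebra_correlation_linear[OF BS]
  have \<K>: "coalgebra_map K V (scalars K) \<K>"
    and \<K>_eq: "\<And>x. x \<in> carrier (schur K V) \<Longrightarrow> cofree_lift K (scalars K) (scalars K) ?\<phi>K (\<K> x) =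
      schur_map K V (scalars K) E (cofree_lift K V V ?\<phi>V x)"
    using assms(4) by (auto simp: cumulant_morphism_def)
  have \<K>_linear: "\<K> \<in> linear_maps K (schur K V) (schur K (scalars K))"
    using \<K> by (simp add: coalgebra_map_def)
  let ?k = "schur_counit K (scalars K) \<circ> \<K>"
  have k: "?k \<in> linear_maps K (schur K V) (scalars K)"
    by (rule linear_maps_comp[OF \<K>_linear schur_counit_linear[OF S]])
  have moments: "?\<phi>K (cofree_lift K V (scalars K) ?k x) = E (?\<phi>V x)" if x: "x \<in> carrier (schur K V)" for x
  proof -
    have "?\<phi>K (\<K> x) = schur_counit K (scalars K) (cofree_lift K (scalars K) (scalars K) ?\<phi>K (\<K> x))"
      by (rule schur_counit_cofree_lift[OF S S \<phi>K linear_maps_closed[OF \<K>_linear x], symmetric])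
    \<comment> \<open>On the right, functoriality merges the expectation with the correlation map of
      \<open>V\<close>, giving the lift of one linear map, to which the counit law applies a second
      time.\<close>
    also have "cofree_lift K (scalars K) (scalars K) ?\<phi>K (\<K> x) = cofree_lift K V (scalars K) (E \<circ> ?\<phi>V) x"
    proof (rule trans[OF \<K>_eq[OF x]])
      show "schur_map K V (scalars K) E (cofree_lift K V V ?\<phi>V x) = cofree_lift K V (scalars K) (E \<circ> ?\<phi>V) x"
        unfolding cofree_lift_def comp_apply[of "schur_map _ _ _ _"]
        by (rule schur_map_comp[OF module_schur[OF V] V S \<phi>V E linear_maps_closed[OF schur_comult_linear[OF V] x]])
    qed
    also have "schur_counit K (scalars K) (cofree_lift K V (scalars K) (E \<circ> ?\<phi>V) x) = E (?\<phi>V x)"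
      using schur_counit_cofree_lift[OF V S linear_maps_comp[OF \<phi>V E] x] by simp
    finally show ?thesis
      using coalgebra_map_eq_cofree_lift[OF V S \<K> x] by simp
  qed
  \<comment> \<open>The cumulant morphism recast as functionals on lists, with the i-th vector
    decorating the letter \<open>i\<close>, so that both families have the form required by the
    recursion.\<close>
  let ?\<kappa> = "\<lambda>n xs. ?k (schur_class K V [1..<Suc n] (\<lambda>i. xs ! (i - 1)))"
  have word: "[1..<Suc n] \<in> nc_words (set [1..<Suc n])" if "n \<ge> 1" for n
    by (rule distinct_in_nc_words) (use that in auto)
  have "?\<kappa> N (map v [1..<Suc N]) = \<kappa> N (map v [1..<Suc N])"
  proof (rule moment_cumulant_unique[OF K, where A = "carrier V"])
    fix n and xs :: "'v list" assume n: "n \<ge> 1" "length xs = n" "set xs \<subseteq> carrier V"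
    show "\<kappa> n xs \<in> carrier K"
      using assms(5) n by (auto simp: free_cumulants_def multilinear_form_def)
    have "schur_class K V [1..<Suc n] (\<lambda>i. xs ! (i - 1)) \<in> carrier (schur K V)"
    proof (rule schur_class_closed[OF V word[OF n(1)]], rule funcsetI)
      fix i assume "i \<in> set [1..<Suc n]"
      then have "xs ! (i - 1) \<in> set xs" using n(2) by (intro nth_mem) auto
      then show "xs ! (i - 1) \<in> carrier V" using n(3) by blast
    qed
    then show "?\<kappa> n xs \<in> carrier K" using linear_maps_closed[OF k] by simp
  next
    fix n and a assume n: "(n :: nat) \<ge> 1" and a: "a \<in> {1..n} \<rightarrow> carrier V"
    have w: "[1..<Suc n] \<in> nc_words (set [1..<Suc n])" by (rule word[OF n])
    have z: "a \<in> set [1..<Suc n] \<rightarrow> carrier V" using a by auto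
    have "(\<Oplus>\<^bsub>K\<^esub> f \<in> nc_partitions n. mult_extension K ?\<kappa> n f a) = E (?\<phi>V (schur_class K V [1..<Suc n] a))"
      unfolding moments[OF schur_class_closed[OF V w z], symmetric]
      by (rule algebra_correlation_cofree_lift[OF K V k n a, symmetric])
    \<comment> \<open>In 1, ..., n every letter is its own first occurrence, so the correlation map
      multiplies the vectors in their given order and yields the moment.\<close>
    also have "\<dots> = E (list_product V (map a [1..<Suc n]))"
      using algebra_correlation_class[OF B w z] by (simp add: first_occurrences_distinct)
    also have "\<dots> = (\<Oplus>\<^bsub>K\<^esub> f \<in> nc_partitions n. mult_extension K \<kappa> n f a)"
      using assms(5) n a by (simp add: free_cumulants_def)
    finally show "(\<Oplus>\<^bsub>K\<^esub> f \<in> nc_partitions n. mult_extension K ?\<kappa> n f a) =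
      (\<Oplus>\<^bsub>K\<^esub> f \<in> nc_partitions n. mult_extension K \<kappa> n f a)" .
  qed (use assms(6,7) in auto)
  moreover have "schur_class K V [1..<Suc N] (\<lambda>i. map v [1..<Suc N] ! (i - 1)) = schur_class K V [1..<Suc N] v"
    by (rule schur_class_cong[OF V]) (auto simp del: upt_Suc)
  ultimately show ?thesis by simp
qed

end
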